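(* Let $n\ge2$ and let $X^\tau=X_{\tau_1}\times X_{\tau_2}\times\cdots\times X_{\tau_m}$, where each $X_{\tau_k}$ is the basic affine geometric crystal $X_M$ or the dual basic affine geometric crystal $X_N$ of type $A_{n-1}^{(1)}$. Let $N^\tau$ be the network on a cylinder consisting of $n$ horizontal wires $W_1,\dots,W_n$, not crossing each other and connecting $n$ sources on the left boundary to $n$ sinks on the right boundary, together with $m$ wire cycles $C_1,\dots,C_m$ (from left to right), each going once around the cylinder and crossing each $W_j$ once, where $C_k$ is a whirl if $X_{\tau_k}=X_M$ and a curl if $X_{\tau_k}=X_N$. Then $N^\tau$ is a network model for the geometric crystal $X^\tau$; that is, identifying the weight $x_k^{(j)}\in\mathbb C^*$ of the crossing of $W_j$ with $C_k$ with the $j$-th coordinate of the $k$-th factor of $X^\tau$, for every $j\in\mathbb Z/n\mathbb Z$: (1) the functions $\varepsilon(W_j,W_{j+1})$ and $\varphi(W_j,W_{j+1})$ agree with the functions $\varepsilon_j$ and $\varphi_j$ of $X^\tau$; (2) the wiring crystal action $e^c(\cdot,W_j,W_{j+1})$ agrees with the geometric crystal action $e_j^c$ of $X^\tau$.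
   Context: Geometric crystals. $X_M=\{x=(x^{(1)},\dots,x^{(n)}):x^{(i)}\in\mathbb C^*\}$ (indices mod $n$) with $\varepsilon_i(x)=x^{(i+1)}$, $\varphi_i(x)=x^{(i)}$, $\gamma_i=\varphi_i/\varepsilon_i$, and $e_i^c$ multiplying $x^{(i)}$ by $c$ and $x^{(i+1)}$ by $c^{-1}$. $X_N$ is the same variety with $\varepsilon_i(x)=x^{(i)}$, $\varphi_i(x)=x^{(i+1)}$, $\gamma_i=\varphi_i/\varepsilon_i$, and $e_i^c$ multiplying $x^{(i)}$ by $c^{-1}$ and $x^{(i+1)}$ by $c$. The product $X\times X'$ of geometric crystals has $$\varepsilon_k(x,x')=\frac{\varepsilon_k(x)\varepsilon_k(x')}{\varphi_k(x')+\varepsilon_k(x)},\quad \varphi_k(x,x')=\frac{\varphi_k(x)\varphi_k(x')}{\varepsilon_k(x)+\varphi_k(x')},\quad e_k^c(x,x')=(e_k^{c^+}x,e_k^{c/c^+}x'),\quad c^+=\frac{c\varphi_k(x')+\varepsilon_k(x)}{\varphi_k(x')+\varepsilon_k(x)}.$$ Networks. Networks are oriented, embedded in an oriented surface, with each interior vertex (crossing) having two adjacent incoming and two adjacent outgoing edges, and a weight. At a crossing let $e_1,e_2,f_1,f_2$ be the edges in counterclockwise order, $e_i$ incoming, $f_i$ outgoing; $e_1,f_1$ is the highway, $e_2,f_2$ the underway. A wire goes straight ($e_1\to f_1$, $e_2\to f_2$) through each crossing. A whirl (curl) is a wire cycle crossed by the other wires from its left (right). The horizontal wires are oriented from left to right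 and numbered cyclically so that $W_{j+1}$ is the next wire to the right of $W_j$ (i.e. from top to bottom). So whirls are oriented up, curls down. Wiring crystal. Two wires $W,W'$ with endpoints on the same boundary components are parallel, $W$ to the left of $W'$, if the part of the surface to the right of $W$ and left of $W'$ is a strip without interior vertices or isolated loops, and each wire crossing $W$ from left to right (resp. $W'$ from right to left) next crosses $W'$ from left to right (resp. $W$ from right to left) before meeting any other wire. Number the orthogonal crossings $1,\dots,m$ along the direction of $W$, with weights $x^{(i)}$ on $W$ and $y^{(i)}$ on $W'$. Put $z^{(i)}=x^{(i)},\ t^{(i)}=y^{(i)}$ if the $i$-th orthogonal wire meets $W'$ first, and $z^{(i)}=y^{(i)},\ t^{(i)}=x^{(i)}$ if it meets $W$ first. Let $D=\sum_{s=0}^{m-1}t^{(1)}\cdots t^{(s)}z^{(s+2)}\cdots z^{(m)}$ and $$\varphi(W,W')=\frac{\prod_{i=1}^m z^{(i)}}{D},\qquad \varepsilon(W,W')=\frac{\prod_{i=1}^m t^{(i)}}{D}.$$ For $c\in\mathbb C^*$ the network $e^c(\mathcal N,W,W')$ is obtained as follows: add two crossings of $W$ with $W'$, a crossing $v$ before all interior vertices of $W,W'$ with weight $(c-1)\varphi(W,W')$ and a crossing $u$ after all of them with weight $(c^{-1}-1)\varepsilon(W,W')$; move $v$ past all orthogonal wires using the Yang–Baxter move; $v$ then has weight opposite to that of $u$ and $u,v$ are both removed. Yang–Baxter move: for three wire segments pairwise crossing once and forming an empty triangle that is not an oriented cycle, with crossings ordered $v_1,v_2,v_3$ (edges $v_1\to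 v_2\to v_3$, $v_1\to v_3$) of weights $x,y,z$, slide one segment across the crossing of the other two; the new crossings, ordered likewise, have weights $\frac{yz}{x+z},x+z,\frac{xy}{x+z}$. All identities are of rational functions/birational maps. *)

theory Defs
  imports Complex_Main "HOL-Combinatorics.Transposition"
begin

section \<open>Geometric crystals\<close>

text \<open>
  Structure maps of a geometric crystal are rational maps. A rational map is represented by a total
  function together with the set of points at which its defining formula involves no division by
  zero: \<open>gc_reg X k\<close> for the pair \<open>gc_eps X k\<close>, \<open>gc_phi X k\<close>, and \<open>gc_act_reg X k c\<close> for
  \<open>gc_act X k c\<close>. In all crystals below $\gamma_k = \varphi_k / \varepsilon_k$, so it is not a
  separate field. The index set $Z/n$ is represented by the naturals below \<open>n\<close>.
\<close>

record 'x gcrystal =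
  gc_points :: "'x set"
  gc_eps :: "nat \<Rightarrow> 'x \<Rightarrow> complex"
  gc_phi :: "nat \<Rightarrow> 'x \<Rightarrow> complex"
  gc_act :: "nat \<Rightarrow> complex \<Rightarrow> 'x \<Rightarrow> 'x"
  gc_reg :: "nat \<Rightarrow> 'x set"
  gc_act_reg :: "nat \<Rightarrow> complex \<Rightarrow> 'x set"

definition torus :: "nat \<Rightarrow> (nat \<Rightarrow> complex) set" where
  "torus n = {x. \<forall>i<n. x i \<noteq> 0}"

definition crystal_M :: "nat \<Rightarrow> (nat \<Rightarrow> complex) gcrystal" where
  "crystal_M n = \<lparr>
     gc_points = torus n,
     gc_eps = (\<lambda>i x. x (Suc i mod n)),
     gc_phi = (\<lambda>i x. x i),
     gc_act = (\<lambda>i c x. x(i := c * x i, Suc i mod n := inverse c * x (Suc i mod n))),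
     gc_reg = (\<lambda>i. torus n),
     gc_act_reg = (\<lambda>i c. {x \<in> torus n. c \<noteq> 0}) \<rparr>"

definition crystal_N :: "nat \<Rightarrow> (nat \<Rightarrow> complex) gcrystal" where
  "crystal_N n = \<lparr>
     gc_points = torus n,
     gc_eps = (\<lambda>i x. x i),
     gc_phi = (\<lambda>i x. x (Suc i mod n)),
     gc_act = (\<lambda>i c x. x(i := inverse c * x i, Suc i mod n := c * x (Suc i mod n))),
     gc_reg = (\<lambda>i. torus n),
     gc_act_reg = (\<lambda>i c. {x \<in> torus n. c \<noteq> 0}) \<rparr>"

definition c_plus :: "'x gcrystal \<Rightarrow> 'y gcrystal \<Rightarrow> nat \<Rightarrow> complex \<Rightarrow> 'x \<times> 'y \<Rightarrow> complex" where
  "c_plus X Y k c p =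
     (c * gc_phi Y k (snd p) + gc_eps X k (fst p)) / (gc_phi Y k (snd p) + gc_eps X k (fst p))"

definition crystal_prod :: "'x gcrystal \<Rightarrow> 'y gcrystal \<Rightarrow> ('x \<times> 'y) gcrystal" where
  "crystal_prod X Y = \<lparr>
     gc_points = gc_points X \<times> gc_points Y,
     gc_eps = (\<lambda>k (x, x'). gc_eps X k x * gc_eps Y k x' / (gc_phi Y k x' + gc_eps X k x)),
     gc_phi = (\<lambda>k (x, x'). gc_phi X k x * gc_phi Y k x' / (gc_eps X k x + gc_phi Y k x')),
     gc_act = (\<lambda>k c (x, x'). (gc_act X k (c_plus X Y k c (x, x')) x,
                              gc_act Y k (c / c_plus X Y k c (x, x')) x')),
     gc_reg = (\<lambda>k. {(x, x'). x \<in> gc_reg X k \<and> x' \<in> gc_reg Y k \<and>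
                             gc_phi Y k x' + gc_eps X k x \<noteq> 0}),
     gc_act_reg = (\<lambda>k c. {(x, x'). x \<in> gc_reg X k \<and> x' \<in> gc_reg Y k \<and>
                             gc_phi Y k x' + gc_eps X k x \<noteq> 0 \<and>
                             c_plus X Y k c (x, x') \<noteq> 0 \<and>
                             x \<in> gc_act_reg X k (c_plus X Y k c (x, x')) \<and>
                             x' \<in> gc_act_reg Y k (c / c_plus X Y k c (x, x'))}) \<rparr>"

text \<open>Transport of structure along an injection \<open>g\<close> with left inverse \<open>f\<close>.\<close>

definition crystal_transport :: "('y \<Rightarrow> 'x) \<Rightarrow> ('x \<Rightarrow> 'y) \<Rightarrow> 'x gcrystal \<Rightarrow> 'y gcrystal" where
  "crystal_transport f g X = \<lparr>
     gc_points = g ` gc_points X,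
     gc_eps = (\<lambda>k y. gc_eps X k (f y)),
     gc_phi = (\<lambda>k y. gc_phi X k (f y)),
     gc_act = (\<lambda>k c y. g (gc_act X k c (f y))),
     gc_reg = (\<lambda>k. g ` gc_reg X k),
     gc_act_reg = (\<lambda>k c. g ` gc_act_reg X k c) \<rparr>"

datatype basic_type = TypeM | TypeN

fun basic_crystal :: "nat \<Rightarrow> basic_type \<Rightarrow> (nat \<Rightarrow> complex) gcrystal" where
  "basic_crystal n TypeM = crystal_M n"
| "basic_crystal n TypeN = crystal_N n"

text \<open>
  The iterated product, its points being lists with one entry per factor. The product of geometric
  crystals is associative; it is bracketed to the right here. The value on the empty list is not
  used.
\<close>

fun crystal_tau :: "nat \<Rightarrow> basic_type list \<Rightarrow> (nat \<Rightarrow> complex) list gcrystal" where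
  "crystal_tau n [] = undefined"
| "crystal_tau n [t] = crystal_transport hd (\<lambda>x. [x]) (basic_crystal n t)"
| "crystal_tau n (t # t' # ts) =
     crystal_transport (\<lambda>xs. (hd xs, tl xs)) (\<lambda>(x, xs). x # xs)
       (crystal_prod (basic_crystal n t) (crystal_tau n (t' # ts)))"


section \<open>Networks\<close>

text \<open>
  A crossing \<open>v\<close> carries two strands: \<open>St v Hi\<close> is the highway, entering along $e_1$ and leaving
  along $f_1$, and \<open>St v Lo\<close> is the underway, entering along $e_2$ and leaving along $f_2$. Because
  $e_1, e_2, f_1, f_2$ is the counterclockwise order around \<open>v\<close>, the highway crosses the underway
  from left to right (and the underway crosses the highway from right to left).

  An edge is given by its tail (a source on the boundary, or the outgoing end of a strand) and its
  head (a sink on the boundary, or the incoming end of a strand); \<open>nxt\<close> maps tails to heads. A wire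
  is thus an orbit of \<open>nxt\<close>. An open wire is referred to by its source.

  The boundary vertices on one boundary component are cyclically ordered by \<open>bnxt\<close>, the component
  being traversed with the surface on its left. These data determine the faces of the network; the
  surface is the one obtained by filling each face with a disc.
\<close>

datatype role = Hi | Lo

fun opp :: "role \<Rightarrow> role" where
  "opp Hi = Lo"
| "opp Lo = Hi"

datatype ('v, 'b) node = Bd 'b | St (crossing: 'v) (role_at: role)

record ('v, 'b) network =
  verts :: "'v set"
  srcs :: "'b set"
  snks :: "'b set"
  nxt :: "('v, 'b) node \<Rightarrow> ('v, 'b) node"
  bnxt :: "'b \<Rightarrow> 'b"
  weight :: "'v \<Rightarrow> complex"

definition strands :: "('v, 'b) network \<Rightarrow> ('v, 'b) node set" where
  "strands N = {St v r | v r. v \<in> verts N}"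

definition wf_network :: "('v, 'b) network \<Rightarrow> bool" where
  "wf_network N \<longleftrightarrow>
     finite (verts N) \<and> finite (srcs N) \<and> finite (snks N) \<and> srcs N \<inter> snks N = {} \<and>
     bij_betw (nxt N) (Bd ` srcs N \<union> strands N) (Bd ` snks N \<union> strands N) \<and>
     bij_betw (bnxt N) (srcs N \<union> snks N) (srcs N \<union> snks N)"

text \<open>Isomorphisms fix the boundary vertices, hence respect the naming of the open wires.\<close>

definition network_iso :: "('v, 'b) network \<Rightarrow> ('w, 'b) network \<Rightarrow> bool" where
  "network_iso N N' \<longleftrightarrow>
     srcs N' = srcs N \<and> snks N' = snks N \<and> (\<forall>b \<in> srcs N \<union> snks N. bnxt N' b = bnxt N b) \<and>
     (\<exists>f. bij_betw f (verts N) (verts N') \<and>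
          (\<forall>v \<in> verts N. weight N' (f v) = weight N v) \<and>
          (\<forall>a \<in> Bd ` srcs N \<union> strands N.
             nxt N' (map_node f id a) = map_node f id (nxt N a)))"


subsection \<open>Parallel wires\<close>

text \<open>The number of crossings on the wire with source \<open>W\<close>, and its \<open>i\<close>-th strand (\<open>i \<ge> 1\<close>).\<close>

definition wire_len :: "('v, 'b) network \<Rightarrow> 'b \<Rightarrow> nat" where
  "wire_len N W = (LEAST m. \<exists>t. (nxt N ^^ Suc m) (Bd W) = Bd t)"

definition wire_pos :: "('v, 'b) network \<Rightarrow> 'b \<Rightarrow> nat \<Rightarrow> ('v, 'b) node" where
  "wire_pos N W i = (nxt N ^^ i) (Bd W)"

abbreviation wire_crossing :: "('v, 'b) network \<Rightarrow> 'b \<Rightarrow> nat \<Rightarrow> 'v" where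
  "wire_crossing N W i \<equiv> crossing (wire_pos N W i)"

definition crossed_from_right :: "('v, 'b) network \<Rightarrow> 'b \<Rightarrow> nat \<Rightarrow> bool" where
  "crossed_from_right N W i \<longleftrightarrow> wire_pos N W i = St (wire_crossing N W i) Hi"

definition crossed_from_left :: "('v, 'b) network \<Rightarrow> 'b \<Rightarrow> nat \<Rightarrow> bool" where
  "crossed_from_left N W i \<longleftrightarrow> wire_pos N W i = St (wire_crossing N W i) Lo"

text \<open>
  \<open>W\<close> is to the left of \<open>W'\<close>. The region between them is a strip without interior vertices exactly
  if it consists of the two end faces, cut off by boundary arcs joining neighbouring endpoints, and
  of quadrilateral faces separated by edges joining the \<open>i\<close>-th crossing of \<open>W\<close> with the \<open>i\<close>-th
  crossing of \<open>W'\<close>. Isolated loops do not exist in this encoding.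
\<close>

definition parallel_wires :: "('v, 'b) network \<Rightarrow> 'b \<Rightarrow> 'b \<Rightarrow> bool" where
  "parallel_wires N W W' \<longleftrightarrow>
     W \<in> srcs N \<and> W' \<in> srcs N \<and> W \<noteq> W' \<and> bnxt N W = W' \<and>
     (\<exists>m T T'. wire_len N W = m \<and> wire_len N W' = m \<and>
        T \<in> snks N \<and> T' \<in> snks N \<and>
        wire_pos N W (Suc m) = Bd T \<and> wire_pos N W' (Suc m) = Bd T' \<and> bnxt N T' = T \<and>
        inj_on (wire_crossing N W) {1..m} \<and> inj_on (wire_crossing N W') {1..m} \<and>
        wire_crossing N W ` {1..m} \<inter> wire_crossing N W' ` {1..m} = {} \<and>
        (\<forall>i \<in> {1..m}.
           (crossed_from_left N W i \<and> crossed_from_left N W' i \<and>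
            nxt N (St (wire_crossing N W i) Hi) = St (wire_crossing N W' i) Hi) \<or>
           (crossed_from_right N W i \<and> crossed_from_right N W' i \<and>
            nxt N (St (wire_crossing N W' i) Lo) = St (wire_crossing N W i) Lo)))"


subsection \<open>Wiring crystal\<close>

text \<open>
  A wire crossing the strip from right to left meets \<open>W'\<close> first, one crossing it from left to right
  meets \<open>W\<close> first. (Successorship along the orthogonal wire alone would not decide this: a wire
  cycle with just two crossings meets \<open>W\<close> right after \<open>W'\<close> and \<open>W'\<close> right after \<open>W\<close>.)
\<close>

definition z_wt :: "('v, 'b) network \<Rightarrow> 'b \<Rightarrow> 'b \<Rightarrow> nat \<Rightarrow> complex" where
  "z_wt N W W' i =
     (if crossed_from_right N W i then weight N (wire_crossing N W i)
      else weight N (wire_crossing N W' i))"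

definition t_wt :: "('v, 'b) network \<Rightarrow> 'b \<Rightarrow> 'b \<Rightarrow> nat \<Rightarrow> complex" where
  "t_wt N W W' i =
     (if crossed_from_right N W i then weight N (wire_crossing N W' i)
      else weight N (wire_crossing N W i))"

definition wiring_D :: "('v, 'b) network \<Rightarrow> 'b \<Rightarrow> 'b \<Rightarrow> complex" where
  "wiring_D N W W' =
     (\<Sum>s<wire_len N W. (\<Prod>i=1..s. t_wt N W W' i) * (\<Prod>i=s+2..wire_len N W. z_wt N W W' i))"

definition wiring_phi :: "('v, 'b) network \<Rightarrow> 'b \<Rightarrow> 'b \<Rightarrow> complex" where
  "wiring_phi N W W' = (\<Prod>i=1..wire_len N W. z_wt N W W' i) / wiring_D N W W'"

definition wiring_eps :: "('v, 'b) network \<Rightarrow> 'b \<Rightarrow> 'b \<Rightarrow> complex" where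
  "wiring_eps N W W' = (\<Prod>i=1..wire_len N W. t_wt N W W' i) / wiring_D N W W'"

text \<open>
  Cross the edge with tail \<open>a\<close> with the edge with tail \<open>b\<close> to its right, at a new crossing \<open>w\<close> of
  weight \<open>p\<close>. The strand coming from \<open>a\<close> crosses from left to right and so is the highway.
\<close>

definition add_crossing ::
  "'v \<Rightarrow> complex \<Rightarrow> ('v, 'b) node \<Rightarrow> ('v, 'b) node \<Rightarrow> ('v, 'b) network \<Rightarrow> ('v, 'b) network" where
  "add_crossing w p a b N = N\<lparr>
     verts := insert w (verts N),
     nxt := (nxt N)(a := St w Hi, b := St w Lo, St w Hi := nxt N b, St w Lo := nxt N a),
     weight := (weight N)(w := p) \<rparr>"

text \<open>
  Empty triangle with edges $v_1 \to v_2 \to v_3$ and $v_1 \to v_3$. The three edges bound a face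
  lying to the left (\<open>r = Hi\<close>) or to the right (\<open>r = Lo\<close>) of the path $v_1 \to v_2 \to v_3$
  precisely when the strands have the roles below.
\<close>

definition yb_triangle :: "('v, 'b) network \<Rightarrow> role \<Rightarrow> 'v \<Rightarrow> 'v \<Rightarrow> 'v \<Rightarrow> bool" where
  "yb_triangle N r v1 v2 v3 \<longleftrightarrow>
     v1 \<in> verts N \<and> v2 \<in> verts N \<and> v3 \<in> verts N \<and> v1 \<noteq> v2 \<and> v1 \<noteq> v3 \<and> v2 \<noteq> v3 \<and>
     nxt N (St v1 r) = St v2 r \<and>
     nxt N (St v2 (opp r)) = St v3 (opp r) \<and>
     nxt N (St v1 (opp r)) = St v3 r"

text \<open>
  Sliding one segment across the crossing of the other two interchanges the two crossings on each of
  the three segments; which wire is the highway at the crossing of two given wires does not change.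
  A crossing keeps its name when it remains the crossing of the same two wires, so the new triangle
  has edges $v_3 \to v_2 \to v_1$ and $v_3 \to v_1$.
\<close>

definition yb_perm :: "role \<Rightarrow> 'v \<Rightarrow> 'v \<Rightarrow> 'v \<Rightarrow> ('v, 'b) node \<Rightarrow> ('v, 'b) node" where
  "yb_perm r v1 v2 v3 =
     transpose (St v1 r) (St v2 r) \<circ>
     transpose (St v2 (opp r)) (St v3 (opp r)) \<circ>
     transpose (St v1 (opp r)) (St v3 r)"

definition yb_move ::
  "'v \<Rightarrow> 'v \<Rightarrow> 'v \<Rightarrow> ('v, 'b) network \<Rightarrow> ('v, 'b) network \<Rightarrow> bool" where
  "yb_move v1 v2 v3 N N' \<longleftrightarrow>
     (\<exists>r. yb_triangle N r v1 v2 v3 \<and>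
       (let x = weight N v1; y = weight N v2; z = weight N v3 in
          x + z \<noteq> 0 \<and>
          N' = N\<lparr>
            nxt := yb_perm r v1 v2 v3 \<circ> nxt N \<circ> yb_perm r v1 v2 v3,
            weight := (weight N)(v3 := y * z / (x + z), v2 := x + z, v1 := x * y / (x + z)) \<rparr>))"

text \<open>
  Removal of two crossings \<open>v\<close>, \<open>u\<close> of opposite weights at which the same two wires cross
  consecutively. The highway at \<open>v\<close> is the underway at \<open>u\<close>.
\<close>

definition cancel_crossings :: "'v \<Rightarrow> 'v \<Rightarrow> ('v, 'b) network \<Rightarrow> ('v, 'b) network \<Rightarrow> bool" where
  "cancel_crossings v u N N' \<longleftrightarrow>
     nxt N (St v Hi) = St u Lo \<and> nxt N (St v Lo) = St u Hi \<and> weight N v = - weight N u \<and>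
     N' = N\<lparr>
       verts := verts N - {v, u},
       nxt := (\<lambda>a. if nxt N a = St v Hi then nxt N (St u Lo)
                   else if nxt N a = St v Lo then nxt N (St u Hi)
                   else nxt N a) \<rparr>"

text \<open>
  \<open>N'\<close> is the network $e^c(N, W, W')$. Since \<open>v\<close> and \<open>u\<close> are arbitrary fresh names and the
  Yang--Baxter moves interchange the crossings of an orthogonal wire with \<open>W\<close> and \<open>W'\<close>, it is
  determined up to \<open>network_iso\<close> only.
\<close>

definition wiring_action ::
  "complex \<Rightarrow> 'b \<Rightarrow> 'b \<Rightarrow> ('v, 'b) network \<Rightarrow> ('v, 'b) network \<Rightarrow> bool" where
  "wiring_action c W W' N N' \<longleftrightarrow>
     parallel_wires N W W' \<and>
     (\<exists>v u Ns. let m = wire_len N W in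
        v \<notin> verts N \<and> u \<notin> verts N \<and> v \<noteq> u \<and>
        Ns 0 =
          add_crossing v ((c - 1) * wiring_phi N W W') (Bd W) (Bd W')
            (add_crossing u ((inverse c - 1) * wiring_eps N W W')
               (wire_pos N W m) (wire_pos N W' m) N) \<and>
        (\<forall>i \<in> {1..m}.
           if crossed_from_right N W i
           then yb_move v (wire_crossing N W' i) (wire_crossing N W i) (Ns (i - 1)) (Ns i)
           else yb_move v (wire_crossing N W i) (wire_crossing N W' i) (Ns (i - 1)) (Ns i)) \<and>
        cancel_crossings v u (Ns m) N')"


subsection \<open>The cylindric network\<close>

text \<open>
  The crossing of the \<open>k\<close>-th cycle (from the left) with the \<open>j\<close>-th horizontal wire is \<open>(k, j)\<close>;
  both indices start at \<open>0\<close>. Horizontal wires run from left to right and are numbered from top to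
  bottom. A whirl runs upwards, so the horizontal wires cross it from its left and are highways
  there; a curl runs downwards, and the horizontal wires are underways there.
\<close>

datatype cyl_boundary = Source nat | Sink nat

fun horizontal_role :: "basic_type \<Rightarrow> role" where
  "horizontal_role TypeM = Hi"
| "horizontal_role TypeN = Lo"

fun cycle_step :: "nat \<Rightarrow> basic_type \<Rightarrow> nat \<Rightarrow> nat" where
  "cycle_step n TypeM j = (j + n - 1) mod n"
| "cycle_step n TypeN j = Suc j mod n"

definition horizontal_node ::
  "basic_type list \<Rightarrow> nat \<Rightarrow> nat \<Rightarrow> (nat \<times> nat, cyl_boundary) node" where
  "horizontal_node ts j k =
     (if k < length ts then St (k, j) (horizontal_role (ts ! k)) else Bd (Sink j))"

text \<open>The last equation is irrelevant, as sinks are not tails of edges.\<close>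

fun cyl_nxt ::
  "nat \<Rightarrow> basic_type list \<Rightarrow> (nat \<times> nat, cyl_boundary) node \<Rightarrow> (nat \<times> nat, cyl_boundary) node"
where
  "cyl_nxt n ts (Bd (Source j)) = horizontal_node ts j 0"
| "cyl_nxt n ts (St (k, j) r) =
     (if r = horizontal_role (ts ! k) then horizontal_node ts j (Suc k)
      else St (k, cycle_step n (ts ! k) j) r)"
| "cyl_nxt n ts (Bd (Sink j)) = Bd (Sink j)"

text \<open>With the cylinder on its left, the left boundary runs downwards, the right one upwards.\<close>

fun cyl_bnxt :: "nat \<Rightarrow> cyl_boundary \<Rightarrow> cyl_boundary" where
  "cyl_bnxt n (Source j) = Source (Suc j mod n)"
| "cyl_bnxt n (Sink j) = Sink ((j + n - 1) mod n)"

definition cyl_network ::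
  "nat \<Rightarrow> basic_type list \<Rightarrow> (nat \<Rightarrow> complex) list \<Rightarrow> (nat \<times> nat, cyl_boundary) network" where
  "cyl_network n ts xs = \<lparr>
     verts = {..<length ts} \<times> {..<n},
     srcs = Source ` {..<n},
     snks = Sink ` {..<n},
     nxt = cyl_nxt n ts,
     bnxt = cyl_bnxt n,
     weight = (\<lambda>(k, j). (xs ! k) j) \<rparr>"

end

theory Submission
  imports Defs
begin

text \<open>
  Fix neighbouring wires \<open>W\<close> and \<open>W'\<close>. Both sides of the statement are governed by the same two
  numbers per cycle: \<open>z\<^sub>k\<close>, the weight of the crossing that the cycle meets second, and \<open>t\<^sub>k\<close>, the weight
  of the one that it meets first. For a whirl and for a curl alike these are \<open>\<phi>\<^sub>j\<close> and \<open>\<epsilon>\<^sub>j\<close> of the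
  corresponding factor (\<open>cyl_weights\<close>), so a whirl and a curl need no separate treatment afterwards.

  For the functions, the denominator of the wiring crystal satisfies
  \<open>D = z\<^sub>2 \<cdots> z\<^sub>m + t\<^sub>1 D'\<close>, where \<open>D'\<close> belongs to the cycles after the first. With
  \<open>\<phi>' = z\<^sub>2 \<cdots> z\<^sub>m / D'\<close> this reads \<open>D = D' (\<phi>' + t\<^sub>1)\<close>, which is the denominator in the product of
  crystals; induction on the number of factors gives \<open>\<epsilon>\<close> and \<open>\<phi>\<close> (\<open>tau_closed_form\<close>).

  For the action, let \<open>p\<^sub>k\<close> be the weight of the sliding crossing after \<open>k\<close> moves. A move replaces \<open>z\<close> by
  \<open>p + z\<close>, \<open>t\<close> by \<open>t z / (p + z)\<close> and \<open>p\<close> by \<open>p t / (p + z)\<close>; thus it multiplies \<open>z\<close> by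
  \<open>(p + z) / z\<close> and divides \<open>t\<close> by the same factor, which is the form of the action on one factor of the
  product. Starting from \<open>p = (c - 1) \<phi>\<close>, that factor is \<open>c\<^sup>+\<close>, and the next value of \<open>p\<close> is
  \<open>(c / c\<^sup>+ - 1) \<phi>'\<close>, that is, the starting value for the remaining factors with parameter \<open>c / c\<^sup>+\<close>.
  At the end \<open>p = (1 - 1 / c) \<epsilon>\<close>, the opposite of the weight of \<open>u\<close> (\<open>tau_action\<close>).

  It remains to see that the moves are possible and give back the same network. This holds for any pair of
  parallel wires: after \<open>i\<close> moves the network is the original one with the extra crossing inserted behind
  the \<open>i\<close>-th orthogonal wire, up to interchanging the names of the two crossings on each of the first
  \<open>i\<close> orthogonal wires (\<open>yb_move_tracks\<close>). After the last move the two extra crossings are adjacent and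
  cancel (\<open>cancel_tracks\<close>), so that the action only changes weights (\<open>wiring_action_reweights\<close>).

  Finally, the formulas are defined on a dense set. Once the remaining factors are at a regular point, the
  point is perturbed in the \<open>\<epsilon>\<close>-coordinate of the first factor alone: all but finitely many values of it
  are admissible, because \<open>c / c\<^sup>+\<close> is a nonconstant Moebius function of that coordinate unless \<open>c = 1\<close>, and a
  given point fails to be regular for only finitely many values of the parameter
  (\<open>tau_act_reg_cofinite\<close>, \<open>tau_dense\<close>).
\<close>


section \<open>Moving a crossing along two edges\<close>

lemma opp_neq [simp]: "opp r \<noteq> r" "r \<noteq> opp r" and opp_opp [simp]: "opp (opp r) = r"
  by (cases r; simp)+

lemma role_neq: "(r' \<noteq> r) = (r' = opp r)"
  by (cases r; cases r'; simp)

definition tails :: "('v, 'b) network \<Rightarrow> ('v, 'b) node set" where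
  "tails N = Bd ` srcs N \<union> strands N"

definition splice ::
  "'v \<Rightarrow> ('v, 'b) node \<Rightarrow> ('v, 'b) node \<Rightarrow> (('v, 'b) node \<Rightarrow> ('v, 'b) node) \<Rightarrow>
   ('v, 'b) node \<Rightarrow> ('v, 'b) node" where
  "splice w a b f = f(a := St w Hi, b := St w Lo, St w Hi := f b, St w Lo := f a)"

lemma nxt_add_crossing: "nxt (add_crossing w p a b N) = splice w a b (nxt N)"
  by (simp add: add_crossing_def splice_def)

text \<open>
  Conjugation by this permutation moves a crossing \<open>v\<close> that exchanges two strands from just before to just
  after the strand pieces \<open>a\<close> and \<open>b\<close>. The cycle has length four, and not two of length two, because the two
  strands swap sides at \<open>v\<close>.
\<close>

definition rotate4 :: "'v \<Rightarrow> ('v, 'b) node \<Rightarrow> ('v, 'b) node \<Rightarrow> ('v, 'b) node \<Rightarrow> ('v, 'b) node" where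
  "rotate4 v a b e =
     (if e = St v Hi then a else if e = a then St v Lo
      else if e = St v Lo then b else if e = b then St v Hi else e)"

text \<open>
  Following the edges from \<open>a\<close>: with the crossing in front one passes \<open>a\<close>, \<open>St v Hi\<close>, \<open>f b\<close>; with the crossing
  behind one passes \<open>a\<close>, \<open>f a\<close>, \<open>St v Hi\<close>. The rotation matches the two paths, and everything off
  these strands is unaffected since \<open>f\<close> is injective.
\<close>

lemma splice_rotate:
  assumes inj: "inj_on f U" and U: "a \<in> U" "b \<in> U" "f a \<in> U" "f b \<in> U"
    and dist: "a \<noteq> b" "f a \<noteq> a" "f a \<noteq> b" "f b \<noteq> a" "f b \<noteq> b"
    and v: "\<And>r. St v r \<notin> U" "\<And>e r. e \<in> U \<Longrightarrow> f e \<noteq> St v r"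
    and e: "e \<in> U \<or> (\<exists>r. e = St v r)"
  shows "splice v (f a) (f b) f (rotate4 v (f a) (f b) e) = rotate4 v (f a) (f b) (splice v a b f e)"
proof -
  have ab: "f a \<noteq> f b" using inj U dist by (auto dest: inj_onD)
  have vn: "St v r \<noteq> a" "St v r \<noteq> b" "St v r \<noteq> f a" "St v r \<noteq> f b" for r
    using U v(1)[of r] by metis+
  note vn' = vn vn[symmetric]
  have e': "e \<in> U \<or> e = St v Hi \<or> e = St v Lo"
    using e by (metis (full_types) role.exhaust)
  consider "e = St v Hi" | "e = St v Lo" | "e \<in> U" "e = a" | "e \<in> U" "e = b"
    | "e \<in> U" "e = f a" | "e \<in> U" "e = f b"
    | "e \<in> U" "e \<noteq> a" "e \<noteq> b" "e \<noteq> f a" "e \<noteq> f b"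
    using e' by blast
  then show ?thesis
  proof cases
    case 5
    have "f (f a) \<noteq> f a" "f (f a) \<noteq> f b" "f (f a) \<noteq> St v r" for r
      using inj U dist v by (auto dest: inj_onD)
    then show ?thesis using 5 vn' dist ab by (simp add: splice_def rotate4_def)
  next
    case 6
    have "f (f b) \<noteq> f a" "f (f b) \<noteq> f b" "f (f b) \<noteq> St v r" for r
      using inj U dist v by (auto dest: inj_onD)
    then show ?thesis using 6 vn' dist ab by (simp add: splice_def rotate4_def)
  next
    case 7
    have "f e \<noteq> f a" "f e \<noteq> f b" using inj U 7 by (auto dest: inj_onD)
    moreover have "f e \<noteq> St v r" "e \<noteq> St v r" for r using 7 v by auto
    ultimately show ?thesis using 7 by (simp add: splice_def rotate4_def)
  qed (use vn' dist ab in \<open>simp_all add: splice_def rotate4_def\<close>)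
qed

text \<open>
  A Yang--Baxter move keeps the names of crossings with their pairs of wires. When the names of \<open>x\<close> and \<open>y\<close>
  are exchanged, the orthogonal wire is untouched by the move and only the rotation along the two sliding
  strands is left. Which of \<open>x\<close>, \<open>y\<close> lies on the left wire, with strand piece \<open>a\<close>, depends on the
  side \<open>r\<close> of the triangle.
\<close>

lemma yb_perm_rename:
  assumes "v \<noteq> x" "v \<noteq> y" "x \<noteq> y"
    and ab: "(a, b) = (if r = Hi then (St y r, St x r) else (St x r, St y r))"
  shows "map_node (transpose x y) id (yb_perm r v x y e) = rotate4 v a b e"
proof (cases e)
  case (Bd c)
  then show ?thesis using assms
    by (cases r) (simp_all add: yb_perm_def rotate4_def transpose_def)
next
  case (St w r')
  then show ?thesis using assms
    by (cases r; cases r') (auto simp add: yb_perm_def rotate4_def transpose_def)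
qed

lemma yb_perm_involution:
  assumes "v \<noteq> x" "v \<noteq> y" "x \<noteq> y"
  shows "yb_perm r v x y (yb_perm r v x y e) = e"
proof (cases e)
  case (Bd c)
  then show ?thesis by (simp add: yb_perm_def transpose_def)
next
  case (St w r')
  then show ?thesis using assms
    by (cases r; cases r') (auto simp add: yb_perm_def transpose_def)
qed

text \<open>
  Renaming crossings away from the triangle commutes with the move.
\<close>

lemma yb_perm_equivariant:
  assumes "inj g" "g v = v" "g x = x" "g y = y"
  shows "yb_perm r v x y (map_node g id e) = map_node g id (yb_perm r v x y e)"
proof -
  have "inj (map_node g (id :: 'b \<Rightarrow> 'b))"
    using node.inj_map[OF assms(1), of "id :: 'b \<Rightarrow> 'b"] by simp
  then have "transpose (map_node g id p) (map_node g id q) (map_node g id z)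
      = map_node g id (transpose p q z)" for p q z :: "('a, 'b) node"
    by (auto simp: transpose_def dest: injD)
  from this[of "St v r" "St x r"] this[of "St x (opp r)" "St y (opp r)"]
    this[of "St v (opp r)" "St y r"]
  show ?thesis using assms by (simp add: yb_perm_def)
qed


section \<open>The strip between two parallel wires\<close>

text \<open>
  Weight of a crossing of initial weight \<open>p\<close> after passing \<open>i\<close> orthogonal wires.
\<close>

primrec slide_weight :: "(nat \<Rightarrow> complex) \<Rightarrow> (nat \<Rightarrow> complex) \<Rightarrow> complex \<Rightarrow> nat \<Rightarrow> complex" where
  "slide_weight z t p 0 = p"
| "slide_weight z t p (Suc i) =
     slide_weight z t p i * t (Suc i) / (slide_weight z t p i + z (Suc i))"

definition z_crossing :: "('v, 'b) network \<Rightarrow> 'b \<Rightarrow> 'b \<Rightarrow> nat \<Rightarrow> 'v" where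
  "z_crossing N W W' i =
     (if crossed_from_right N W i then wire_crossing N W i else wire_crossing N W' i)"

definition t_crossing :: "('v, 'b) network \<Rightarrow> 'b \<Rightarrow> 'b \<Rightarrow> nat \<Rightarrow> 'v" where
  "t_crossing N W W' i =
     (if crossed_from_right N W i then wire_crossing N W' i else wire_crossing N W i)"

text \<open>
  In the locale, \<open>a\<close> and \<open>b\<close> enumerate the strand pieces of \<open>W\<close> and \<open>W'\<close>. On the \<open>i\<close>-th orthogonal wire,
  \<open>t_vertex i\<close> is the crossing met first and \<open>z_vertex i\<close> the one met second; in these terms both directions of
  crossing the strip look alike.
\<close>

locale strip =
  fixes N :: "('v, 'b) network" and W W' :: 'b
  assumes wf: "wf_network N" and parallel: "parallel_wires N W W'"
begin

definition "m = wire_len N W"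
definition "a = wire_pos N W"
definition "b = wire_pos N W'"
definition wire_role :: "nat \<Rightarrow> role" where "wire_role i = (if crossed_from_right N W i then Hi else Lo)"
definition left_vertex :: "nat \<Rightarrow> 'v" where "left_vertex i = crossing (a i)"
definition right_vertex :: "nat \<Rightarrow> 'v" where "right_vertex i = crossing (b i)"
definition t_vertex :: "nat \<Rightarrow> 'v" where "t_vertex = t_crossing N W W'"
definition z_vertex :: "nat \<Rightarrow> 'v" where "z_vertex = z_crossing N W W'"

lemma t_vertex_eq: "t_vertex i = (if wire_role i = Hi then right_vertex i else left_vertex i)"
  and z_vertex_eq: "z_vertex i = (if wire_role i = Hi then left_vertex i else right_vertex i)"
  by (simp_all add: t_vertex_def z_vertex_def z_crossing_def t_crossing_def
      left_vertex_def right_vertex_def a_def b_def wire_role_def)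

lemma step: "a (Suc i) = nxt N (a i)" "b (Suc i) = nxt N (b i)"
  by (simp_all add: a_def b_def wire_pos_def)

lemma start: "a 0 = Bd W" "b 0 = Bd W'" "W \<noteq> W'" "W \<in> srcs N" "W' \<in> srcs N"
  using parallel by (auto simp: a_def b_def wire_pos_def parallel_wires_def)

lemma wire_nodes:
  assumes "i \<in> {1..m}"
  shows "a i = St (left_vertex i) (wire_role i)" and "b i = St (right_vertex i) (wire_role i)"
    and orthogonal: "nxt N (St (t_vertex i) (opp (wire_role i))) = St (z_vertex i) (opp (wire_role i))"
proof -
  have "(crossed_from_left N W i \<and> crossed_from_left N W' i \<and>
            nxt N (St (wire_crossing N W i) Hi) = St (wire_crossing N W' i) Hi) \<or>
           (crossed_from_right N W i \<and> crossed_from_right N W' i \<and>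
            nxt N (St (wire_crossing N W' i) Lo) = St (wire_crossing N W i) Lo)"
    using parallel assms by (auto simp: parallel_wires_def m_def)
  then consider (left) "a i = St (left_vertex i) Lo" "b i = St (right_vertex i) Lo"
      "nxt N (St (left_vertex i) Hi) = St (right_vertex i) Hi"
    | (right) "a i = St (left_vertex i) Hi" "b i = St (right_vertex i) Hi"
      "nxt N (St (right_vertex i) Lo) = St (left_vertex i) Lo"
    unfolding crossed_from_left_def crossed_from_right_def
      left_vertex_def right_vertex_def a_def b_def by blast
  then have "a i = St (left_vertex i) (wire_role i) \<and> b i = St (right_vertex i) (wire_role i) \<and>
      nxt N (St (t_vertex i) (opp (wire_role i))) = St (z_vertex i) (opp (wire_role i))"
  proof cases
    case left
    then have "wire_role i = Lo" by (simp add: wire_role_def crossed_from_right_def a_def)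
    then show ?thesis using left by (simp add: t_vertex_eq z_vertex_eq)
  next
    case right
    then have "wire_role i = Hi" by (simp add: wire_role_def crossed_from_right_def a_def)
    then show ?thesis using right by (simp add: t_vertex_eq z_vertex_eq)
  qed
  then show "a i = St (left_vertex i) (wire_role i)" and "b i = St (right_vertex i) (wire_role i)"
    and "nxt N (St (t_vertex i) (opp (wire_role i))) = St (z_vertex i) (opp (wire_role i))" by simp_all
qed

lemma crossing_eqs:
  assumes "i \<in> {1..m}" "k \<in> {1..m}"
  shows "left_vertex i = left_vertex k \<longleftrightarrow> i = k"
    and "right_vertex i = right_vertex k \<longleftrightarrow> i = k"
    and "left_vertex i \<noteq> right_vertex k"
proof -
  have "inj_on (wire_crossing N W) {1..m}" "inj_on (wire_crossing N W') {1..m}"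
    "wire_crossing N W ` {1..m} \<inter> wire_crossing N W' ` {1..m} = {}"
    using parallel by (auto simp: parallel_wires_def m_def)
  then show "left_vertex i = left_vertex k \<longleftrightarrow> i = k"
    and "right_vertex i = right_vertex k \<longleftrightarrow> i = k"
    and "left_vertex i \<noteq> right_vertex k"
    using assms unfolding left_vertex_def right_vertex_def a_def b_def by (blast dest: inj_onD)+
qed

lemma t_z_vertex_eqs:
  assumes "i \<in> {1..m}" "k \<in> {1..m}"
  shows "t_vertex i = t_vertex k \<longleftrightarrow> i = k" "z_vertex i = z_vertex k \<longleftrightarrow> i = k"
    "t_vertex i \<noteq> z_vertex k" "z_vertex k \<noteq> t_vertex i"
  using crossing_eqs[OF assms] crossing_eqs[OF assms(2,1)]
  by (auto simp: t_vertex_eq z_vertex_eq)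

lemma wire_nodes_t_z:
  assumes "i \<in> {1..m}"
  shows "(a i, b i) = (if wire_role i = Hi then (St (z_vertex i) (wire_role i), St (t_vertex i) (wire_role i))
                                    else (St (t_vertex i) (wire_role i), St (z_vertex i) (wire_role i)))"
  using wire_nodes(1,2)[OF assms] by (auto simp: t_vertex_eq z_vertex_eq)

lemma nxt_inj: "inj_on (nxt N) (tails N)"
  and nxt_heads: "e \<in> tails N \<Longrightarrow> nxt N e \<in> Bd ` snks N \<union> strands N"
  using wf by (auto simp: wf_network_def bij_betw_def tails_def)

lemma wire_tails: "i \<le> m \<Longrightarrow> a i \<in> tails N \<and> b i \<in> tails N"
proof (induction i)
  case 0
  then show ?case using start by (simp add: tails_def)
next
  case (Suc i)
  then have i: "Suc i \<in> {1..m}" by simp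
  have "a (Suc i) \<in> Bd ` snks N \<union> strands N" "b (Suc i) \<in> Bd ` snks N \<union> strands N"
    using Suc nxt_heads step by simp_all
  moreover have "a (Suc i) \<noteq> Bd t" "b (Suc i) \<noteq> Bd t" for t
    using wire_nodes(1,2)[OF i] by simp_all
  ultimately show ?case by (auto simp: tails_def)
qed

lemma t_z_vertex_verts:
  assumes "i \<in> {1..m}" shows "t_vertex i \<in> verts N" "z_vertex i \<in> verts N"
proof -
  have "a i \<in> tails N" "b i \<in> tails N" using wire_tails[of i] assms by simp_all
  then have "left_vertex i \<in> verts N" "right_vertex i \<in> verts N"
    using wire_nodes(1,2)[OF assms] by (auto simp: tails_def strands_def)
  then show "t_vertex i \<in> verts N" "z_vertex i \<in> verts N" by (auto simp: t_vertex_eq z_vertex_eq)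
qed

lemma wire_positions_eqs:
  assumes "i \<le> m" "k \<le> m"
  shows "a i = a k \<longleftrightarrow> i = k" "b i = b k \<longleftrightarrow> i = k" "a i \<noteq> b k" "b k \<noteq> a i"
proof -
  have st: "a j \<noteq> Bd x" "b j \<noteq> Bd x" "Bd x \<noteq> a j" "Bd x \<noteq> b j" if "j \<noteq> 0" "j \<le> m" for j x
    using wire_nodes(1,2)[of j] that by simp_all
  have "(a i = a k \<longleftrightarrow> i = k) \<and> (b i = b k \<longleftrightarrow> i = k) \<and> a i \<noteq> b k"
  proof (cases "i = 0 \<or> k = 0")
    case True
    then show ?thesis using st[of i] st[of k] assms start
      by (cases "i = 0"; cases "k = 0") simp_all
  next
    case False
    then have "i \<in> {1..m}" "k \<in> {1..m}" using assms by simp_all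
    then show ?thesis using crossing_eqs[of i k] wire_nodes(1,2)[of i] wire_nodes(1,2)[of k] by auto
  qed
  then show "a i = a k \<longleftrightarrow> i = k" "b i = b k \<longleftrightarrow> i = k" "a i \<noteq> b k" "b k \<noteq> a i" by auto
qed

lemma orthogonal_off_wire:
  assumes "i \<in> {1..m}" "k \<le> m" "c = t_vertex i \<or> c = z_vertex i"
  shows "St c (opp (wire_role i)) \<noteq> a k" "St c (opp (wire_role i)) \<noteq> b k"
proof -
  have c: "c = left_vertex i \<or> c = right_vertex i" using assms(3) by (auto simp: t_vertex_eq z_vertex_eq)
  have "St c (opp (wire_role i)) \<noteq> a k \<and> St c (opp (wire_role i)) \<noteq> b k"
  proof (cases "k = 0")
    case True
    then show ?thesis using start by simp
  next
    case False
    then have k: "k \<in> {1..m}" using assms by simp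
    show ?thesis
    proof (cases "i = k")
      case True
      then show ?thesis using wire_nodes(1,2)[OF k] by simp
    next
      case False
      then show ?thesis
        using c crossing_eqs[OF assms(1) k] crossing_eqs[OF k assms(1)]
          wire_nodes(1,2)[OF k] by auto
    qed
  qed
  then show "St c (opp (wire_role i)) \<noteq> a k" "St c (opp (wire_role i)) \<noteq> b k" by auto
qed

text \<open>
  Interchanges the names of the two crossings on each of the first \<open>i\<close> orthogonal wires: the discrepancy
  between names and positions after \<open>i\<close> moves.
\<close>

primrec exchange :: "nat \<Rightarrow> 'v \<Rightarrow> 'v" where
  "exchange 0 = id"
| "exchange (Suc i) = exchange i \<circ> transpose (t_vertex (Suc i)) (z_vertex (Suc i))"

lemma exchange_fixes: "c \<notin> t_vertex ` {1..i} \<union> z_vertex ` {1..i} \<Longrightarrow> exchange i c = c"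
proof (induction i)
  case (Suc i)
  then have "c \<noteq> t_vertex (Suc i)" "c \<noteq> z_vertex (Suc i)" "c \<notin> t_vertex ` {1..i} \<union> z_vertex ` {1..i}" by auto
  then show ?case using Suc.IH by (simp add: transpose_def)
qed simp

lemma exchange_bij: "bij (exchange i)"
  by (induction i) (simp_all only: exchange.simps bij_id bij_comp bij_transpose)

lemma exchange_fixes_later:
  assumes "i < k" "k \<le> m"
  shows "exchange i (t_vertex k) = t_vertex k" "exchange i (z_vertex k) = z_vertex k"
proof -
  have "t_vertex k \<noteq> t_vertex l \<and> t_vertex k \<noteq> z_vertex l \<and> z_vertex k \<noteq> t_vertex l \<and> z_vertex k \<noteq> z_vertex l"
    if "l \<in> {1..i}" for l
    using t_z_vertex_eqs[of k l] t_z_vertex_eqs[of l k] that assms by auto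
  then show "exchange i (t_vertex k) = t_vertex k" "exchange i (z_vertex k) = z_vertex k"
    by - (rule exchange_fixes, blast)+
qed

lemma exchange_involution: "i \<le> m \<Longrightarrow> exchange i (exchange i c) = c"
proof (induction i arbitrary: c)
  case (Suc i)
  let ?t = "transpose (t_vertex (Suc i)) (z_vertex (Suc i))"
  note fixed = exchange_fixes_later[of i "Suc i", OF lessI Suc.prems]
  have "exchange i c = t_vertex (Suc i) \<longleftrightarrow> c = t_vertex (Suc i)"
    "exchange i c = z_vertex (Suc i) \<longleftrightarrow> c = z_vertex (Suc i)" for c
    using fixed bij_is_inj[OF exchange_bij, of i] by (metis injD)+
  then have "?t (exchange i c) = exchange i (?t c)" for c
    by (simp add: transpose_def fixed)
  then show ?case using Suc by simp
qed simp

lemma exchange_verts: "i \<le> m \<Longrightarrow> c \<in> verts N \<Longrightarrow> exchange i c \<in> verts N"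
  by (induction i arbitrary: c) (use t_z_vertex_verts in \<open>auto simp: transpose_def\<close>)

end


section \<open>Yang--Baxter moves through the strip\<close>

lemma splice_inj:
  assumes "inj_on f T" "a \<in> T" "b \<in> T" "a \<noteq> b"
    and "\<And>r. St w r \<notin> T" "\<And>e r. e \<in> T \<Longrightarrow> f e \<noteq> St w r"
  shows "inj_on (splice w a b f) (T \<union> {St w Hi, St w Lo})"
proof (rule inj_onI)
  fix x y
  assume xy: "x \<in> T \<union> {St w Hi, St w Lo}" "y \<in> T \<union> {St w Hi, St w Lo}"
    "splice w a b f x = splice w a b f y"
  have ne: "a \<noteq> St w r" "b \<noteq> St w r" "f a \<noteq> St w r" "f b \<noteq> St w r" for r
    using assms by metis+
  have inj: "f x = f y \<longleftrightarrow> x = y" if "x \<in> T" "y \<in> T" for x y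
    using assms(1) that by (auto dest: inj_onD)
  have T: "x \<noteq> St w r" "f x \<noteq> St w r" if "x \<in> T" for x r using assms(5,6) that by metis+
  note simps = splice_def ne ne[symmetric] inj assms(2,3,4) assms(4)[symmetric] T T[symmetric]
  show "x = y"
    using xy by (auto simp: simps split: if_splits)
qed

text \<open>
  The two extra crossings \<open>v\<close> and \<open>u\<close> of weights \<open>p\<close> and \<open>q\<close>, and the weights \<open>w\<close> of the original crossings
  after all moves, indexed by the position of a crossing and not by its name during the moves.
\<close>

locale crossed_strip = strip N W W'
  for N :: "('v, 'b) network" and W W' :: 'b +
  fixes v u :: 'v and p q :: complex and w :: "'v \<Rightarrow> complex"
  assumes fresh: "v \<notin> verts N" "u \<notin> verts N" "v \<noteq> u"
    and w_z_vertex: "\<And>k. k \<in> {1..m} \<Longrightarrow>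
      w (z_vertex k) = slide_weight (z_wt N W W') (t_wt N W W') p (k - 1) + z_wt N W W' k"
    and w_t_vertex: "\<And>k. k \<in> {1..m} \<Longrightarrow>
      w (t_vertex k) = t_wt N W W' k * z_wt N W W' k /
        (slide_weight (z_wt N W W') (t_wt N W W') p (k - 1) + z_wt N W W' k)"
    and w_else: "\<And>c. c \<in> verts N \<Longrightarrow> c \<notin> t_vertex ` {1..m} \<union> z_vertex ` {1..m} \<Longrightarrow> w c = weight N c"
begin

definition "v_weight = slide_weight (z_wt N W W') (t_wt N W W') p"
definition "edges_u = splice u (a m) (b m) (nxt N)"

text \<open>
  The edges of the network with \<open>u\<close> at the end of the strip and \<open>v\<close> behind its \<open>i\<close>-th orthogonal wire.
\<close>

definition "edges_vu i = splice v (a i) (b i) edges_u"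
definition "tails_u = tails N \<union> {St u Hi, St u Lo}"
definition "tails_vu = tails_u \<union> {St v Hi, St v Lo}"

abbreviation "ren i \<equiv> map_node (exchange i) (id :: 'b \<Rightarrow> 'b)"

text \<open>
  The invariant: \<open>M\<close> arises from the network with \<open>v\<close> inserted at position \<open>i\<close> by exchanging names on the first
  \<open>i\<close> orthogonal wires. The edge map is constrained on tails of edges only; elsewhere its values carry no
  information and may even point to the fresh crossings.
\<close>

definition tracks :: "nat \<Rightarrow> ('v, 'b) network \<Rightarrow> bool" where "tracks i M \<longleftrightarrow>
   verts M = insert v (insert u (verts N)) \<and> srcs M = srcs N \<and> snks M = snks N \<and> bnxt M = bnxt N \<and>
   (\<forall>e\<in>tails_vu. nxt M (ren i e) = ren i (edges_vu i e)) \<and>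
   weight M v = v_weight i \<and> weight M u = q \<and>
   (\<forall>c\<in>verts N. weight M (exchange i c) =
      (if c \<in> t_vertex ` {1..i} \<union> z_vertex ` {1..i} then w c else weight N c))"

lemma fresh_nodes: "St v r \<notin> tails_u" "e \<in> tails_u \<Longrightarrow> edges_u e \<noteq> St v r"
  "e \<in> tails N \<Longrightarrow> nxt N e \<noteq> St v r" "e \<in> tails N \<Longrightarrow> nxt N e \<noteq> St u r"
  "St u r \<notin> tails N" "St v r \<notin> tails N"
proof -
  show h: "nxt N e \<noteq> St v r" "nxt N e \<noteq> St u r" if "e \<in> tails N" for e r
    using nxt_heads[OF that] fresh by (auto simp: strands_def)
  show "St u r \<notin> tails N" "St v r \<notin> tails N" for r
    using fresh by (auto simp: tails_def strands_def)
  then show "St v r \<notin> tails_u" for r using fresh by (auto simp: tails_u_def)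
  show "e \<in> tails_u \<Longrightarrow> edges_u e \<noteq> St v r" for e r
    using h wire_tails[of m] fresh by (auto simp: tails_u_def edges_u_def splice_def)
qed

lemma edges_u_inj: "inj_on edges_u tails_u"
  unfolding edges_u_def tails_u_def
  by (rule splice_inj) (use nxt_inj wire_tails[of m] wire_positions_eqs[of m m] fresh_nodes in auto)

lemma edges_u_wire: "i < m \<Longrightarrow> edges_u (a i) = a (Suc i)" "i < m \<Longrightarrow> edges_u (b i) = b (Suc i)"
proof -
  assume i: "i < m"
  have "a i \<noteq> St u r" "b i \<noteq> St u r" for r
    using wire_tails[of i] i fresh_nodes(5) by (metis less_imp_le)+
  then show "edges_u (a i) = a (Suc i)" "edges_u (b i) = b (Suc i)"
    using i wire_positions_eqs[of i m] wire_positions_eqs[of m i] by (simp_all add: edges_u_def splice_def step)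
qed

lemma wire_tails_u: "i \<le> m \<Longrightarrow> a i \<in> tails_u" "i \<le> m \<Longrightarrow> b i \<in> tails_u"
  using wire_tails[of i] by (simp_all add: tails_u_def)

lemma edges_vu_rotate:
  assumes i: "i < m" and e: "e \<in> tails_vu"
  shows "edges_vu (Suc i) (rotate4 v (a (Suc i)) (b (Suc i)) e) = rotate4 v (a (Suc i)) (b (Suc i)) (edges_vu i e)"
proof -
  have "e \<in> tails_u \<or> (\<exists>r. e = St v r)" using e by (auto simp: tails_vu_def)
  from splice_rotate[OF edges_u_inj _ _ _ _ _ _ _ _ _ fresh_nodes(1,2) this, of "a i" "b i"]
  show ?thesis
    using i wire_tails_u[of i] wire_tails_u[of "Suc i"] wire_positions_eqs[of i "Suc i"]
      wire_positions_eqs[of "Suc i" i] wire_positions_eqs[of i i]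
    by (simp add: edges_vu_def edges_u_wire)
qed

lemma exchange_fresh: assumes "i \<le> m" shows "exchange i v = v" "exchange i u = u"
proof -
  have "t_vertex ` {1..i} \<union> z_vertex ` {1..i} \<subseteq> verts N" using assms t_z_vertex_verts by auto
  then show "exchange i v = v" "exchange i u = u" using fresh by (blast intro: exchange_fixes)+
qed

lemma exchange_inj: "exchange i c = exchange i d \<longleftrightarrow> c = d"
  using bij_is_inj[OF exchange_bij, of i] by (auto dest: injD)

lemma ren_compose: "ren (Suc i) e = ren i (map_node (transpose (t_vertex (Suc i)) (z_vertex (Suc i))) id e)"
  by (cases e) simp_all

lemma tails_vu_nodes: "St c r \<in> tails_vu \<longleftrightarrow> c \<in> verts N \<or> c = v \<or> c = u"
  by (cases r) (auto simp: tails_vu_def tails_u_def tails_def strands_def)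

lemma yb_perm_tails:
  assumes "x \<in> verts N" "y \<in> verts N" "e \<in> tails_vu"
  shows "yb_perm r v x y e \<in> tails_vu"
proof -
  have "transpose f g d \<in> tails_vu" if "f \<in> tails_vu" "g \<in> tails_vu" "d \<in> tails_vu" for f g d
    using that by (simp add: transpose_def)
  then show ?thesis using assms by (simp add: yb_perm_def tails_vu_nodes)
qed

lemma transpose_tails:
  assumes "x \<in> verts N" "y \<in> verts N" "e \<in> tails_vu"
  shows "map_node (transpose x y) id e \<in> tails_vu"
proof (cases e)
  case (Bd c)
  then show ?thesis using assms by (simp add: tails_vu_def tails_u_def tails_def image_iff strands_def)
next
  case (St c r')
  then show ?thesis using assms by (auto simp: transpose_def tails_vu_nodes)
qed

lemma edges_vu_v: "edges_vu i (St v Hi) = edges_u (b i)" "edges_vu i (St v Lo) = edges_u (a i)"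
  if "i \<le> m"
  using wire_tails_u[OF that] fresh_nodes(1) by (auto simp: edges_vu_def splice_def)

context
  fixes i and M :: "('v, 'b) network" assumes i: "i < m" and tr: "tracks i M"
begin

lemma k: "Suc i \<in> {1..m}" using i by simp

lemma distinct_vertices: "v \<noteq> t_vertex (Suc i)" "v \<noteq> z_vertex (Suc i)" "t_vertex (Suc i) \<noteq> z_vertex (Suc i)"
  "u \<noteq> t_vertex (Suc i)" "u \<noteq> z_vertex (Suc i)"
  using t_z_vertex_verts[OF k] fresh t_z_vertex_eqs[OF k k] by auto

lemma fixed: "exchange i v = v" "exchange i u = u" "exchange i (t_vertex (Suc i)) = t_vertex (Suc i)"
    "exchange i (z_vertex (Suc i)) = z_vertex (Suc i)"
  using exchange_fresh[of i] exchange_fixes_later[of i "Suc i"] i by simp_all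

text \<open>
  The face between \<open>v\<close> and the next orthogonal wire: \<open>v\<close> sends one strand to each crossing on that wire, and the
  wire runs from \<open>t_vertex\<close> to \<open>z_vertex\<close>. This edge is part of the definition of parallel wires, and neither
  the insertions nor the exchanged names affect it.
\<close>

lemma triangle: "yb_triangle M (wire_role (Suc i)) v (t_vertex (Suc i)) (z_vertex (Suc i))"
proof -
  let ?r = "wire_role (Suc i)"
  have nxt: "nxt M (ren i e) = ren i (edges_vu i e)" if "e \<in> tails_vu" for e
    using tr that by (simp add: tracks_def)
  have v: "nxt M (St v r) = ren i (edges_vu i (St v r))" for r
    using nxt[of "St v r"] fixed by (simp add: tails_vu_nodes)
  have "nxt M (St (t_vertex (Suc i)) (opp ?r)) = ren i (edges_vu i (St (t_vertex (Suc i)) (opp ?r)))"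
    using nxt[of "St (t_vertex (Suc i)) (opp ?r)"] fixed t_z_vertex_verts[OF k] by (simp add: tails_vu_nodes)
  also have "edges_vu i (St (t_vertex (Suc i)) (opp ?r)) = nxt N (St (t_vertex (Suc i)) (opp ?r))"
    using orthogonal_off_wire[OF k, of i "t_vertex (Suc i)"] orthogonal_off_wire[OF k, of m "t_vertex (Suc i)"]
      i distinct_vertices by (simp add: edges_vu_def edges_u_def splice_def)
  finally have t: "nxt M (St (t_vertex (Suc i)) (opp ?r)) = St (z_vertex (Suc i)) (opp ?r)"
    using orthogonal[OF k] fixed by simp
  have "verts M = insert v (insert u (verts N))" using tr by (simp add: tracks_def)
  moreover have "nxt M (St v ?r) = St (t_vertex (Suc i)) ?r" "nxt M (St v (opp ?r)) = St (z_vertex (Suc i)) ?r"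
    unfolding v using wire_nodes_t_z[OF k] fixed i by (cases ?r; simp add: edges_vu_v edges_u_wire)+
  ultimately show ?thesis
    using distinct_vertices t_z_vertex_verts[OF k] t by (simp add: yb_triangle_def)
qed

lemma triangle_role:
  assumes "yb_triangle M r v (t_vertex (Suc i)) (z_vertex (Suc i))" shows "r = wire_role (Suc i)"
proof (rule ccontr)
  assume "r \<noteq> wire_role (Suc i)"
  then have "r = opp (wire_role (Suc i))" by (simp add: role_neq)
  then show False using assms triangle distinct_vertices by (simp add: yb_triangle_def)
qed

lemma crossing_weights: "weight M v = v_weight i" "weight M (t_vertex (Suc i)) = t_wt N W W' (Suc i)"
  "weight M (z_vertex (Suc i)) = z_wt N W W' (Suc i)"
proof -
  show "weight M v = v_weight i" using tr by (simp add: tracks_def)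
  have "weight M (exchange i c) = weight N c" if "c = t_vertex (Suc i) \<or> c = z_vertex (Suc i)" for c
  proof -
    have "c \<in> verts N" using that t_z_vertex_verts[OF k] by auto
    moreover have "c \<noteq> t_vertex l \<and> c \<noteq> z_vertex l"
    if "l \<in> {1..i}" for l
      using that \<open>c = _ \<or> _\<close> t_z_vertex_eqs[OF k, of l] t_z_vertex_eqs[of l, OF _ k] i by auto
    then have "c \<notin> t_vertex ` {1..i} \<union> z_vertex ` {1..i}" by blast
    ultimately show ?thesis using tr by (simp add: tracks_def)
  qed
  from this[of "t_vertex (Suc i)"] this[of "z_vertex (Suc i)"]
  show "weight M (t_vertex (Suc i)) = t_wt N W W' (Suc i)" "weight M (z_vertex (Suc i)) = z_wt N W W' (Suc i)"
    using fixed by (simp_all add: t_vertex_def z_vertex_def t_crossing_def z_crossing_def t_wt_def z_wt_def)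
qed

text \<open>
  The side of the triangle is determined by the network, hence a move has exactly one result, and it exists
  when its denominator does not vanish.
\<close>

lemma yb_move_iff:
  "yb_move v (t_vertex (Suc i)) (z_vertex (Suc i)) M M' \<longleftrightarrow>
     v_weight i + z_wt N W W' (Suc i) \<noteq> 0 \<and>
     M' = M\<lparr>nxt := yb_perm (wire_role (Suc i)) v (t_vertex (Suc i)) (z_vertex (Suc i)) \<circ> nxt M \<circ>
                     yb_perm (wire_role (Suc i)) v (t_vertex (Suc i)) (z_vertex (Suc i)),
            weight := (weight M)(z_vertex (Suc i) := w (t_vertex (Suc i)), t_vertex (Suc i) := w (z_vertex (Suc i)),
                                 v := v_weight (Suc i))\<rparr>"
proof -
  have "(\<exists>r. yb_triangle M r v (t_vertex (Suc i)) (z_vertex (Suc i)) \<and> Q r) \<longleftrightarrow> Q (wire_role (Suc i))" for Q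
    using triangle triangle_role by blast
  moreover have "w (z_vertex (Suc i)) = v_weight i + z_wt N W W' (Suc i)"
    "w (t_vertex (Suc i)) = t_wt N W W' (Suc i) * z_wt N W W' (Suc i) / (v_weight i + z_wt N W W' (Suc i))"
    "v_weight (Suc i) = v_weight i * t_wt N W W' (Suc i) / (v_weight i + z_wt N W W' (Suc i))"
    using w_z_vertex[OF k] w_t_vertex[OF k] by (simp_all add: v_weight_def)
  ultimately show ?thesis by (simp add: yb_move_def crossing_weights Let_def)
qed

lemma yb_move_tracks:
  assumes "yb_move v (t_vertex (Suc i)) (z_vertex (Suc i)) M M'"
  shows "tracks (Suc i) M'"
proof -
  let ?x = "t_vertex (Suc i)" and ?y = "z_vertex (Suc i)" and ?r = "wire_role (Suc i)"
  let ?yb = "yb_perm ?r v ?x ?y :: ('v, 'b) node \<Rightarrow> _"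
  let ?sw = "map_node (transpose ?x ?y) (id :: 'b \<Rightarrow> 'b)"
  let ?rot = "rotate4 v (a (Suc i)) (b (Suc i))"
  have M': "M' = M\<lparr>nxt := ?yb \<circ> nxt M \<circ> ?yb,
            weight := (weight M)(?y := w ?x, ?x := w ?y, v := v_weight (Suc i))\<rparr>"
    using assms by (simp add: yb_move_iff)
  have yb: "?yb (?yb e) = e" for e
    by (rule yb_perm_involution[OF distinct_vertices(1,2,3)])
  have sw: "?sw (?sw e) = e" for e by (cases e) simp_all
  have rot: "?sw (?yb e) = ?rot e" for e
    using yb_perm_rename[OF distinct_vertices(1,2,3), of "a (Suc i)" "b (Suc i)" ?r] wire_nodes_t_z[OF k]
    by blast
  have comm: "?yb (ren i e) = ren i (?yb e)" for e
    by (rule yb_perm_equivariant) (use fixed bij_is_inj[OF exchange_bij] in auto)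
  have nxt: "nxt M' (ren (Suc i) e) = ren (Suc i) (edges_vu (Suc i) e)" if e: "e \<in> tails_vu" for e
  proof -
    \<comment> \<open>the tail that the rotation moves to \<open>e\<close>\<close>
    define d where "d = ?yb (?sw e)"
    have d: "d \<in> tails_vu" unfolding d_def
      by (intro yb_perm_tails transpose_tails t_z_vertex_verts[OF k] e)
    have ed: "e = ?rot d" by (simp only: d_def rot[symmetric] yb sw)
    have "nxt M' (ren (Suc i) e) = ?yb (nxt M (ren i d))"
      by (simp add: M' ren_compose comm d_def del: exchange.simps)
    also have "\<dots> = ?yb (ren i (edges_vu i d))" using tr d by (simp add: tracks_def)
    also have "\<dots> = ren (Suc i) (?sw (?yb (edges_vu i d)))" by (simp only: comm ren_compose sw)
    also have "\<dots> = ren (Suc i) (edges_vu (Suc i) e)" by (simp only: rot ed edges_vu_rotate[OF i d])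
    finally show ?thesis .
  qed
  have wt: "weight M' (exchange (Suc i) c) =
      (if c \<in> t_vertex ` {1..Suc i} \<union> z_vertex ` {1..Suc i} then w c else weight N c)" if c: "c \<in> verts N" for c
  proof -
    consider "c = ?x" | "c = ?y" | "c \<noteq> ?x" "c \<noteq> ?y" by blast
    then show ?thesis
    proof cases
      case 3
      have "exchange i c \<noteq> ?x" "exchange i c \<noteq> ?y" "exchange i c \<noteq> v"
        using 3 c fixed exchange_inj[of i c] fresh by metis+
      moreover have "c \<in> t_vertex ` {1..Suc i} \<union> z_vertex ` {1..Suc i} \<longleftrightarrow> c \<in> t_vertex ` {1..i} \<union> z_vertex ` {1..i}"
        using 3 by (auto simp: atLeastAtMostSuc_conv)
      ultimately show ?thesis using 3 tr c by (simp add: M' tracks_def transpose_def)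
    qed (use distinct_vertices fixed in \<open>simp_all add: M'\<close>)
  qed
  show ?thesis
    using tr nxt wt distinct_vertices fresh unfolding tracks_def by (auto simp: M')
qed

end

lemma tracks_0:
  "tracks 0 (add_crossing v p (Bd W) (Bd W') (add_crossing u q (a m) (b m) N))"
proof -
  have "ren 0 = id" by (simp add: node.map_id0)
  moreover have "weight N' v = p \<and> weight N' u = q \<and> (\<forall>c\<in>verts N. weight N' c = weight N c)"
    if "N' = add_crossing v p (Bd W) (Bd W') (add_crossing u q (a m) (b m) N)" for N'
    using fresh that by (auto simp: add_crossing_def)
  ultimately show ?thesis
    by (simp add: tracks_def nxt_add_crossing edges_vu_def edges_u_def start v_weight_def del: exchange.simps)
      (simp add: add_crossing_def)
qed

lemma ren_involution: "ren m (ren m e) = e"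
  by (cases e) (simp_all add: exchange_involution)

lemma ren_tails: "e \<in> tails N \<Longrightarrow> ren m e \<in> tails N"
  by (auto simp: tails_def strands_def intro: exchange_verts[OF le_refl])

text \<open>
  After the last move \<open>v\<close> and \<open>u\<close> are consecutive on both wires, with highway and underway interchanged. Removing
  them leaves the original edges up to the exchanged names, and the exchange itself is the isomorphism.
\<close>

lemma cancel_tracks:
  assumes tr: "tracks m M" and opposite: "v_weight m = - q"
  shows "\<exists>N'. cancel_crossings v u M N'"
    and "cancel_crossings v u M N' \<Longrightarrow> network_iso N' (N\<lparr>weight := w\<rparr>)"
proof -
  have nxt: "nxt M (ren m e) = ren m (edges_vu m e)" if "e \<in> tails_vu" for e
    using tr that by (simp add: tracks_def)
  have fixed: "exchange m v = v" "exchange m u = u" by (simp_all add: exchange_fresh)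
  have not_u: "a m \<noteq> St u r" "b m \<noteq> St u r" for r
    using wire_tails[of m] fresh_nodes(5) by auto
  have vH: "nxt M (St v r) = St u (opp r)" for r
    using nxt[of "St v r"] fixed not_u wire_positions_eqs[of m m]
    by (cases r) (simp_all add: tails_vu_nodes edges_vu_v edges_u_def splice_def)
  have uH: "nxt M (St u Lo) = ren m (nxt N (a m))" "nxt M (St u Hi) = ren m (nxt N (b m))"
    using nxt[of "St u Lo"] nxt[of "St u Hi"] fixed fresh not_u not_u[symmetric]
    by (auto simp: tails_vu_nodes edges_vu_def edges_u_def splice_def)
  show "\<exists>N'. cancel_crossings v u M N'"
    using vH tr opposite by (simp add: cancel_crossings_def tracks_def)
  assume cancel: "cancel_crossings v u M N'"
  have N': "verts N' = verts N" "srcs N' = srcs N" "snks N' = snks N" "bnxt N' = bnxt N"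
    "weight N' = weight M"
    using cancel tr fresh by (auto simp: cancel_crossings_def tracks_def)
  have nxt': "nxt N' (ren m e) = ren m (nxt N e)" if e: "e \<in> tails N" for e
  proof -
    have N'_nxt: "nxt N' d = (if nxt M d = St v Hi then nxt M (St u Lo)
                   else if nxt M d = St v Lo then nxt M (St u Hi)
                   else nxt M d)" for d
      using cancel by (simp add: cancel_crossings_def)
    have M: "nxt M (ren m e) = ren m (edges_vu m e)"
      using e by (intro nxt) (simp add: tails_vu_def tails_u_def)
    \<comment> \<open>only the tails \<open>a m\<close> and \<open>b m\<close> lead to \<open>v\<close>\<close>
    have ne: "e \<noteq> St v r" "e \<noteq> St u r" "nxt N e \<noteq> St v r" for r
      using e fresh_nodes by metis+
    consider "e = a m" | "e = b m" | "e \<noteq> a m" "e \<noteq> b m" by blast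
    then show ?thesis
    proof cases
      case 3
      have "nxt M (ren m e) = ren m (nxt N e)"
        using M 3 ne by (simp add: edges_vu_def edges_u_def splice_def)
      moreover have "ren m (nxt N e) \<noteq> St v r" for r
        using ne(3)[of r] fixed ren_involution[of "nxt N e"] by auto
      ultimately show ?thesis by (simp add: N'_nxt)
    qed (use M ne uH fixed wire_positions_eqs[of m m] in
        \<open>simp_all add: N'_nxt edges_vu_def splice_def\<close>)
  qed
  have "bij_betw (exchange m) (verts N') (verts N)"
    by (rule bij_betw_byWitness[where f' = "exchange m"])
      (auto simp: N' exchange_involution intro: exchange_verts)
  moreover have "w (exchange m c) = weight N' c" if "c \<in> verts N'" for c
  proof -
    have c: "exchange m c \<in> verts N" using that N' exchange_verts by auto
    then have "weight M (exchange m (exchange m c)) = w (exchange m c)"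
      using tr w_else[OF c] by (auto simp: tracks_def)
    then show ?thesis by (simp add: N' exchange_involution)
  qed
  moreover have "nxt N (ren m d) = ren m (nxt N' d)" if "d \<in> Bd ` srcs N' \<union> strands N'" for d
  proof -
    have "ren m d \<in> tails N" using that ren_tails[of d] by (simp add: tails_def N' strands_def)
    from nxt'[OF this] show ?thesis by (simp add: ren_involution)
  qed
  ultimately show "network_iso N' (N\<lparr>weight := w\<rparr>)"
    unfolding network_iso_def by (auto simp: N' intro!: exI[of _ "exchange m"])
qed

definition slides :: "(nat \<Rightarrow> ('v, 'b) network) \<Rightarrow> bool" where
  "slides Ns \<longleftrightarrow>
     Ns 0 = add_crossing v p (Bd W) (Bd W') (add_crossing u q (a m) (b m) N) \<and>
     (\<forall>i\<in>{1..m}. yb_move v (t_vertex i) (z_vertex i) (Ns (i - 1)) (Ns i))"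

lemma slides_tracks: "slides Ns \<Longrightarrow> i \<le> m \<Longrightarrow> tracks i (Ns i)"
proof (induction i)
  case 0
  then show ?case using tracks_0 by (simp add: slides_def)
next
  case (Suc i)
  then have "Suc i \<in> {1..m}" by simp
  then have "yb_move v (t_vertex (Suc i)) (z_vertex (Suc i)) (Ns i) (Ns (Suc i))"
    using Suc.prems(1) unfolding slides_def by fastforce
  then show ?case using yb_move_tracks[of i "Ns i"] Suc by simp
qed

lemma slides_exist:
  assumes "\<And>i. i < m \<Longrightarrow> v_weight i + z_wt N W W' (Suc i) \<noteq> 0"
  shows "\<exists>Ns. slides Ns"
proof -
  let ?A = "\<lambda>i M. (i \<le> m \<longrightarrow> tracks i M) \<and>
    (i = 0 \<longrightarrow> M = add_crossing v p (Bd W) (Bd W') (add_crossing u q (a m) (b m) N))"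
  have "\<exists>Ns. \<forall>i. ?A i (Ns i) \<and>
      (i < m \<longrightarrow> yb_move v (t_vertex (Suc i)) (z_vertex (Suc i)) (Ns i) (Ns (Suc i)))"
  proof (rule dependent_nat_choice)
    show "\<exists>M. ?A 0 M" using tracks_0 by blast
    fix M i assume M: "?A i M"
    show "\<exists>M'. ?A (Suc i) M' \<and> (i < m \<longrightarrow> yb_move v (t_vertex (Suc i)) (z_vertex (Suc i)) M M')"
    proof (cases "i < m")
      case True
      then have "tracks i M" using M by simp
      then have "\<exists>M'. yb_move v (t_vertex (Suc i)) (z_vertex (Suc i)) M M'"
        using yb_move_iff[OF True] assms[OF True] by blast
      then show ?thesis using yb_move_tracks[OF True \<open>tracks i M\<close>] by auto
    qed simp
  qed
  then obtain Ns where Ns: "\<And>i. i < m \<Longrightarrow> yb_move v (t_vertex (Suc i)) (z_vertex (Suc i)) (Ns i) (Ns (Suc i))"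
      "Ns 0 = add_crossing v p (Bd W) (Bd W') (add_crossing u q (a m) (b m) N)" by blast
  have "yb_move v (t_vertex i) (z_vertex i) (Ns (i - 1)) (Ns i)" if "i \<in> {1..m}" for i
    using Ns(1)[of "i - 1"] that by (cases i) simp_all
  then show ?thesis using Ns(2) unfolding slides_def by blast
qed

end

text \<open>
  The wiring action changes the weights along the strip and nothing else. The assumption \<open>final\<close> is what makes
  the two extra crossings cancel. Infinitely many names guarantee that \<open>v\<close> and \<open>u\<close> can be chosen.
\<close>

lemma wiring_action_reweights:
  fixes N :: "('v, 'b) network" and c :: complex
  assumes inf: "infinite (UNIV :: 'v set)" and wf: "wf_network N" and par: "parallel_wires N W W'"
  defines "z \<equiv> z_wt N W W'" and "t \<equiv> t_wt N W W'" and "l \<equiv> wire_len N W"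
  defines "s \<equiv> slide_weight z t ((c - 1) * wiring_phi N W W')"
  assumes nonzero: "\<And>i. i < l \<Longrightarrow> s i + z (Suc i) \<noteq> 0"
    and final: "s l = (1 - inverse c) * wiring_eps N W W'"
    and w_z: "\<And>i. i < l \<Longrightarrow> w (z_crossing N W W' (Suc i)) = s i + z (Suc i)"
    and w_t: "\<And>i. i < l \<Longrightarrow>
      w (t_crossing N W W' (Suc i)) = t (Suc i) * z (Suc i) / (s i + z (Suc i))"
    and w_else: "\<And>x. x \<in> verts N \<Longrightarrow>
      x \<notin> t_crossing N W W' ` {1..l} \<union> z_crossing N W W' ` {1..l} \<Longrightarrow> w x = weight N x"
  shows "\<exists>N'. wiring_action c W W' N N'"
    and "wiring_action c W W' N N' \<Longrightarrow> network_iso N' (N\<lparr>weight := w\<rparr>)"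
proof -
  interpret strip N W W' using wf par by unfold_locales
  have l: "m = l" by (simp add: m_def l_def)
  let ?p = "(c - 1) * wiring_phi N W W'" and ?q = "(inverse c - 1) * wiring_eps N W W'"
  have crossed: "crossed_strip N W W' v u ?p w" if "v \<notin> verts N" "u \<notin> verts N" "v \<noteq> u" for v u
  proof
    fix k assume k: "k \<in> {1..m}"
    then show "w (z_vertex k) = slide_weight (z_wt N W W') (t_wt N W W') ?p (k - 1) + z_wt N W W' k"
      "w (t_vertex k) = t_wt N W W' k * z_wt N W W' k /
        (slide_weight (z_wt N W W') (t_wt N W W') ?p (k - 1) + z_wt N W W' k)"
      using w_z[of "k - 1"] w_t[of "k - 1"] by (cases k; simp add: l z_vertex_def t_vertex_def s_def z_def t_def)+
  qed (use that w_else in \<open>auto simp: l z_vertex_def t_vertex_def\<close>)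
  have action: "wiring_action c W W' N N' \<longleftrightarrow> (\<exists>v u Ns. v \<notin> verts N \<and> u \<notin> verts N \<and> v \<noteq> u \<and>
      crossed_strip.slides N W W' v u ?p ?q Ns \<and> cancel_crossings v u (Ns l) N')"
    (is "_ \<longleftrightarrow> ?R") for N'
  proof -
    have move: "(if crossed_from_right N W i
           then yb_move v (wire_crossing N W' i) (wire_crossing N W i) M M'
           else yb_move v (wire_crossing N W i) (wire_crossing N W' i) M M') \<longleftrightarrow>
         yb_move v (t_vertex i) (z_vertex i) M M'" for v M M' and i :: nat
      by (simp add: z_vertex_def t_vertex_def z_crossing_def t_crossing_def)
    have "?R \<longleftrightarrow> (\<exists>v u Ns. v \<notin> verts N \<and> u \<notin> verts N \<and> v \<noteq> u \<and>
       Ns 0 = add_crossing v ?p (Bd W) (Bd W')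
          (add_crossing u ?q (wire_pos N W l) (wire_pos N W' l) N) \<and>
       (\<forall>i\<in>{1..l}. yb_move v (t_vertex i) (z_vertex i) (Ns (i - 1)) (Ns i)) \<and> cancel_crossings v u (Ns l) N')"
      using crossed_strip.slides_def[OF crossed, of _ _ ?q]
      by (intro ex_cong1) (auto simp: l a_def b_def)
    then show ?thesis unfolding wiring_action_def Let_def move using par by (simp add: l_def)
  qed
  have tracks: "crossed_strip.tracks N W W' v u ?p ?q w l (Ns l)"
    and opposite: "crossed_strip.v_weight N W W' ?p l = - ?q"
    if "v \<notin> verts N" "u \<notin> verts N" "v \<noteq> u" "crossed_strip.slides N W W' v u ?p ?q Ns" for v u Ns
  proof -
    interpret crossed_strip N W W' v u ?p ?q w using crossed that by blast
    show "tracks l (Ns l)" using slides_tracks[OF that(4), of m] by (simp add: l)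
    have "v_weight l = (1 - inverse c) * wiring_eps N W W'"
      using final unfolding v_weight_def s_def z_def t_def .
    then show "v_weight l = - ?q" by (simp add: left_diff_distrib)
  qed
  show "\<exists>N'. wiring_action c W W' N N'"
  proof -
    have "infinite (UNIV - verts N)" using inf wf by (simp add: wf_network_def)
    then obtain v u where vu: "v \<notin> verts N" "u \<notin> verts N" "v \<noteq> u"
      by (metis DiffD2 Diff_insert infinite_imp_nonempty infinite_remove insertCI ex_in_conv)
    interpret crossed_strip N W W' v u ?p ?q w using crossed[OF vu] .
    obtain Ns where Ns: "slides Ns"
      using slides_exist nonzero by (auto simp: l v_weight_def s_def z_def t_def)
    obtain N' where "cancel_crossings v u (Ns l) N'"
      using cancel_tracks(1)[of "Ns l"] tracks[OF vu Ns] opposite[OF vu Ns] by (auto simp: l)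
    then show ?thesis using action vu Ns by blast
  qed
  assume "wiring_action c W W' N N'"
  then obtain v u Ns where vu: "v \<notin> verts N" "u \<notin> verts N" "v \<noteq> u"
    and Ns: "crossed_strip.slides N W W' v u ?p ?q Ns" and cancel: "cancel_crossings v u (Ns l) N'"
    using action by blast
  interpret crossed_strip N W W' v u ?p ?q w using crossed[OF vu] .
  show "network_iso N' (N\<lparr>weight := w\<rparr>)"
    using cancel_tracks(2)[of "Ns l" N'] tracks[OF vu Ns] opposite[OF vu Ns] cancel by (simp add: l)
qed


section \<open>The iterated product of basic crystals\<close>

text \<open>
  The denominator \<open>D\<close> of the wiring crystal, as a function of the weights alone.
\<close>

definition strip_sum :: "(nat \<Rightarrow> complex) \<Rightarrow> (nat \<Rightarrow> complex) \<Rightarrow> nat \<Rightarrow> complex" where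
  "strip_sum z t m = (\<Sum>s<m. (\<Prod>i=1..s. t i) * (\<Prod>i=s+2..m. z i))"

lemma prod_shift: "(\<Prod>i=Suc k..Suc m. f i) = (\<Prod>i=k..m. f (Suc i :: nat) :: complex)"
  by (rule prod.shift_bounds_cl_Suc_ivl)

lemma prod_first: "(\<Prod>i=1..Suc m. f i) = f (Suc 0) * (\<Prod>i=1..m. f (Suc i) :: complex)"
  by (simp add: prod.atLeast_Suc_atMost prod_shift del: prod.cl_ivl_Suc)

text \<open>
  The summand for \<open>s = 0\<close> contains no \<open>t\<close>; all others contain the factor \<open>t\<close> of the first wire.
\<close>

lemma strip_sum_Suc:
  "strip_sum z t (Suc m) = (\<Prod>i=1..m. z (Suc i)) +
     t (Suc 0) * strip_sum (\<lambda>i. z (Suc i)) (\<lambda>i. t (Suc i)) m"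
proof -
  have "(\<Prod>i=1..Suc s. t i) * (\<Prod>i=Suc s+2..Suc m. z i) =
      t (Suc 0) * ((\<Prod>i=1..s. t (Suc i)) * (\<Prod>i=s+2..m. z (Suc i)))" for s
    by (simp only: prod_first add_Suc prod_shift mult.assoc)
  moreover have "(\<Prod>i=0+2..Suc m. z i) = (\<Prod>i=1..m. z (Suc i))"
    using prod_shift[of z "Suc 0" m] by (simp add: numeral_2_eq_2 del: prod.cl_ivl_Suc)
  ultimately show ?thesis
    unfolding strip_sum_def sum.lessThan_Suc_shift by (simp add: sum_distrib_left)
qed

text \<open>
  Splits off the first move, while the defining equation splits off the last: the product of crystals is
  bracketed to the right.
\<close>

lemma slide_weight_Suc:
  "slide_weight z t p (Suc i) =
     slide_weight (\<lambda>i. z (Suc i)) (\<lambda>i. t (Suc i)) (p * t (Suc 0) / (p + z (Suc 0))) i"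
  by (induction i) simp_all

lemma crystal_tau_Cons:
  "ts \<noteq> [] \<Longrightarrow> crystal_tau n (t # ts) =
     crystal_transport (\<lambda>xs. (hd xs, tl xs)) (\<lambda>(x, xs). x # xs)
       (crystal_prod (basic_crystal n t) (crystal_tau n ts))"
  by (cases ts) (simp_all add: crystal_tau.simps)

lemma in_Cons_image: "ys \<in> (\<lambda>(x, xs). x # xs) ` S \<longleftrightarrow> (\<exists>x xs. ys = x # xs \<and> (x, xs) \<in> S)"
  by auto

lemma basic_sets [simp]:
  "gc_points (basic_crystal n t) = torus n" "gc_reg (basic_crystal n t) j = torus n"
  "gc_act_reg (basic_crystal n t) j c = {x \<in> torus n. c \<noteq> 0}"
  by (cases t; simp add: crystal_M_def crystal_N_def)+

lemma basic_nonzero: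
  assumes "x \<in> torus n" "j < n"
  shows "gc_eps (basic_crystal n t) j x \<noteq> 0" "gc_phi (basic_crystal n t) j x \<noteq> 0"
  using assms by (cases t; simp add: crystal_M_def crystal_N_def torus_def)+

lemma tau_single:
  "gc_points (crystal_tau n [t]) = (\<lambda>x. [x]) ` torus n"
  "gc_reg (crystal_tau n [t]) j = (\<lambda>x. [x]) ` torus n"
  "gc_act_reg (crystal_tau n [t]) j c = (\<lambda>x. [x]) ` {x \<in> torus n. c \<noteq> 0}"
  "gc_eps (crystal_tau n [t]) j [x] = gc_eps (basic_crystal n t) j x"
  "gc_phi (crystal_tau n [t]) j [x] = gc_phi (basic_crystal n t) j x"
  "gc_act (crystal_tau n [t]) j c [x] = [gc_act (basic_crystal n t) j c x]"
  by (simp_all add: crystal_tau.simps crystal_transport_def)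

declare crystal_tau.simps [simp del]

definition head_c_plus :: "nat \<Rightarrow> basic_type \<Rightarrow> basic_type list \<Rightarrow> nat \<Rightarrow> complex \<Rightarrow>
    (nat \<Rightarrow> complex) \<Rightarrow> (nat \<Rightarrow> complex) list \<Rightarrow> complex" where
  "head_c_plus n t ts j c x xs =
     c_plus (basic_crystal n t) (crystal_tau n ts) j c (x, xs)"

lemma tau_Cons:
  assumes "ts \<noteq> []"
  shows "ys \<in> gc_points (crystal_tau n (t # ts)) \<longleftrightarrow>
      (\<exists>x xs. ys = x # xs \<and> x \<in> torus n \<and> xs \<in> gc_points (crystal_tau n ts))"
    and "ys \<in> gc_reg (crystal_tau n (t # ts)) j \<longleftrightarrow>
      (\<exists>x xs. ys = x # xs \<and> x \<in> torus n \<and> xs \<in> gc_reg (crystal_tau n ts) j \<and>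
         gc_phi (crystal_tau n ts) j xs + gc_eps (basic_crystal n t) j x \<noteq> 0)"
    and "ys \<in> gc_act_reg (crystal_tau n (t # ts)) j c \<longleftrightarrow>
      (\<exists>x xs. ys = x # xs \<and> x \<in> torus n \<and> xs \<in> gc_reg (crystal_tau n ts) j \<and>
         gc_phi (crystal_tau n ts) j xs + gc_eps (basic_crystal n t) j x \<noteq> 0 \<and>
         head_c_plus n t ts j c x xs \<noteq> 0 \<and>
         xs \<in> gc_act_reg (crystal_tau n ts) j (c / head_c_plus n t ts j c x xs))"
    and "gc_eps (crystal_tau n (t # ts)) j (x # xs) =
      gc_eps (basic_crystal n t) j x * gc_eps (crystal_tau n ts) j xs /
      (gc_phi (crystal_tau n ts) j xs + gc_eps (basic_crystal n t) j x)"
    and "gc_phi (crystal_tau n (t # ts)) j (x # xs) =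
      gc_phi (basic_crystal n t) j x * gc_phi (crystal_tau n ts) j xs /
      (gc_phi (crystal_tau n ts) j xs + gc_eps (basic_crystal n t) j x)"
    and "gc_act (crystal_tau n (t # ts)) j c (x # xs) =
      gc_act (basic_crystal n t) j (head_c_plus n t ts j c x xs) x #
      gc_act (crystal_tau n ts) j (c / head_c_plus n t ts j c x xs) xs"
  by (auto simp: crystal_tau_Cons[OF assms] crystal_transport_def crystal_prod_def in_Cons_image
      head_c_plus_def add.commute)

lemma head_c_plus_eq:
  "head_c_plus n t ts j c x xs =
     (c * gc_phi (crystal_tau n ts) j xs + gc_eps (basic_crystal n t) j x) /
     (gc_phi (crystal_tau n ts) j xs + gc_eps (basic_crystal n t) j x)"
  by (simp add: head_c_plus_def c_plus_def)

lemma tau_act_reg_reg: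
  "ts \<noteq> [] \<Longrightarrow> xs \<in> gc_act_reg (crystal_tau n ts) j c \<Longrightarrow> xs \<in> gc_reg (crystal_tau n ts) j"
  by (cases ts; cases "tl ts") (auto simp: tau_single tau_Cons)

lemma tau_nonzero:
  assumes "j < n"
  shows "ts \<noteq> [] \<Longrightarrow> xs \<in> gc_reg (crystal_tau n ts) j \<Longrightarrow>
    gc_eps (crystal_tau n ts) j xs \<noteq> 0 \<and> gc_phi (crystal_tau n ts) j xs \<noteq> 0"
  by (induction ts arbitrary: xs rule: list_nonempty_induct)
    (auto simp: tau_single tau_Cons basic_nonzero[OF _ assms])

lemma tau_factor_nonzero:
  assumes "j < n"
  shows "ts \<noteq> [] \<Longrightarrow> xs \<in> gc_reg (crystal_tau n ts) j \<Longrightarrow> i < length ts \<Longrightarrow>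
    gc_phi (basic_crystal n (ts ! i)) j (xs ! i) \<noteq> 0"
  by (induction ts arbitrary: xs i rule: list_nonempty_induct)
    (auto simp: tau_single tau_Cons basic_nonzero[OF _ assms] nth_Cons split: nat.split)

text \<open>
  The recursion \<open>strip_sum_Suc\<close> for \<open>D\<close> is the recursion for the denominators in the product of crystals. The
  sequences \<open>z\<close> and \<open>t\<close> are arbitrary off the range, so that the induction can pass to shifted ones; they are
  indexed from 1, as are the crossings on a wire.
\<close>

lemma tau_closed_form:
  "ts \<noteq> [] \<Longrightarrow> xs \<in> gc_reg (crystal_tau n ts) j \<Longrightarrow>
   (\<And>i. i < length ts \<Longrightarrow> z (Suc i) = gc_phi (basic_crystal n (ts ! i)) j (xs ! i)) \<Longrightarrow>
   (\<And>i. i < length ts \<Longrightarrow> t (Suc i) = gc_eps (basic_crystal n (ts ! i)) j (xs ! i)) \<Longrightarrow>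
   strip_sum z t (length ts) \<noteq> 0 \<and>
   gc_eps (crystal_tau n ts) j xs = (\<Prod>i=1..length ts. t i) / strip_sum z t (length ts) \<and>
   gc_phi (crystal_tau n ts) j xs = (\<Prod>i=1..length ts. z i) / strip_sum z t (length ts)"
proof (induction ts arbitrary: xs z t rule: list_nonempty_induct)
  case (single b)
  then show ?case using single.prems(2)[of 0] single.prems(3)[of 0]
    by (auto simp: tau_single strip_sum_def)
next
  case (cons b ts)
  let ?z = "\<lambda>i. z (Suc i)" and ?t = "\<lambda>i. t (Suc i)" and ?m = "length ts"
  let ?D = "strip_sum ?z ?t ?m" and ?Z = "\<Prod>i=1..?m. ?z i" and ?T = "\<Prod>i=1..?m. ?t i"
  obtain x xs' where xs: "xs = x # xs'" and reg: "xs' \<in> gc_reg (crystal_tau n ts) j"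
    and nz: "gc_phi (crystal_tau n ts) j xs' + gc_eps (basic_crystal n b) j x \<noteq> 0"
    using cons.prems(1) by (auto simp: tau_Cons[OF cons.hyps])
  have IH: "?D \<noteq> 0" "gc_eps (crystal_tau n ts) j xs' = ?T / ?D"
    "gc_phi (crystal_tau n ts) j xs' = ?Z / ?D"
    using cons.IH[OF reg, of ?z ?t] cons.prems(2)[of "Suc _"] cons.prems(3)[of "Suc _"]
    by (simp_all add: xs)
  have first: "z (Suc 0) = gc_phi (basic_crystal n b) j x" "t (Suc 0) = gc_eps (basic_crystal n b) j x"
    using cons.prems(2)[of 0] cons.prems(3)[of 0] by (simp_all add: xs)
  have D: "strip_sum z t (Suc ?m) = ?D * (?Z / ?D + t (Suc 0))"
    using IH(1) by (simp add: strip_sum_Suc field_simps)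
  have nz': "?Z / ?D + t (Suc 0) \<noteq> 0" using nz by (simp add: IH first)
  have "gc_eps (crystal_tau n (b # ts)) j xs = t (Suc 0) * (?T / ?D) / (?Z / ?D + t (Suc 0))"
    "gc_phi (crystal_tau n (b # ts)) j xs = z (Suc 0) * (?Z / ?D) / (?Z / ?D + t (Suc 0))"
    by (simp_all only: xs tau_Cons[OF cons.hyps] IH first)
  moreover have "q * (r / ?D) / w = q * r / (?D * w)" for q r w :: complex by simp
  ultimately show ?case using nz' IH(1) by (simp only: length_Cons D prod_first) simp
qed

text \<open>
  With \<open>h = c\<^sup>+\<close> for the first factor, the identities \<open>s 0 + z\<^sub>1 = h z\<^sub>1\<close> and \<open>s 1 = (c / h - 1) \<phi>'\<close> say that the
  first move acts as \<open>e\<^sup>h\<close> on the first factor and leaves the moving crossing with the initial weight that belongs to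
  \<open>e\<^bsup>c/h\<^esup>\<close> on the remaining ones.
\<close>

lemma tau_action:
  assumes "j < n"
  shows "ts \<noteq> [] \<Longrightarrow> c \<noteq> 0 \<Longrightarrow> xs \<in> gc_act_reg (crystal_tau n ts) j c \<Longrightarrow>
   (\<And>i. i < length ts \<Longrightarrow> z (Suc i) = gc_phi (basic_crystal n (ts ! i)) j (xs ! i)) \<Longrightarrow>
   (\<And>i. i < length ts \<Longrightarrow> t (Suc i) = gc_eps (basic_crystal n (ts ! i)) j (xs ! i)) \<Longrightarrow>
   s = slide_weight z t ((c - 1) * gc_phi (crystal_tau n ts) j xs) \<Longrightarrow>
   (\<forall>i<length ts. s i + z (Suc i) \<noteq> 0 \<and>
      gc_act (crystal_tau n ts) j c xs ! i =
        gc_act (basic_crystal n (ts ! i)) j ((s i + z (Suc i)) / z (Suc i)) (xs ! i)) \<and>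
   s (length ts) = (1 - inverse c) * gc_eps (crystal_tau n ts) j xs"
proof (induction ts arbitrary: xs z t c s rule: list_nonempty_induct)
  case (single b)
  then obtain x where xs: "xs = [x]" and x: "x \<in> torus n" by (auto simp: tau_single)
  have z: "z (Suc 0) = gc_phi (basic_crystal n b) j x" and t: "t (Suc 0) = gc_eps (basic_crystal n b) j x"
    using single.prems(3)[of 0] single.prems(4)[of 0] by (simp_all add: xs)
  have nz: "z (Suc 0) \<noteq> 0" using basic_nonzero[OF x assms] by (simp add: z)
  have s0: "s 0 = (c - 1) * z (Suc 0)" using single.prems(5) by (simp add: xs tau_single z)
  have sum: "s 0 + z (Suc 0) = c * z (Suc 0)" by (simp add: s0 algebra_simps)
  have "s (Suc 0) = s 0 * t (Suc 0) / (s 0 + z (Suc 0))" using single.prems(5) by simp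
  also have "\<dots> = (1 - inverse c) * t (Suc 0)"
    unfolding sum using nz single.prems(1) by (simp add: s0 field_simps)
  finally show ?case
    using nz single.prems(1) sum by (simp add: xs tau_single t[symmetric])
next
  case (cons b ts)
  obtain x xs' where xs: "xs = x # xs'" and x: "x \<in> torus n"
    and S: "gc_phi (crystal_tau n ts) j xs' + gc_eps (basic_crystal n b) j x \<noteq> 0"
    and h: "head_c_plus n b ts j c x xs' \<noteq> 0"
    and reg: "xs' \<in> gc_act_reg (crystal_tau n ts) j (c / head_c_plus n b ts j c x xs')"
    using cons.prems(2) by (auto simp: tau_Cons[OF cons.hyps])
  define h where "h = head_c_plus n b ts j c x xs'"
  define F where "F = gc_phi (crystal_tau n ts) j xs'"
  have z: "z (Suc 0) = gc_phi (basic_crystal n b) j x" and t: "t (Suc 0) = gc_eps (basic_crystal n b) j x"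
    using cons.prems(3)[of 0] cons.prems(4)[of 0] by (simp_all add: xs)
  have nz: "z (Suc 0) \<noteq> 0" using basic_nonzero[OF x assms] by (simp add: z)
  have S': "F + t (Suc 0) \<noteq> 0" and h0: "h \<noteq> 0" using S h by (simp_all add: F_def t h_def)
  have hS: "h * (F + t (Suc 0)) = c * F + t (Suc 0)"
    using S' by (simp add: h_def head_c_plus_eq F_def t)
  have s0: "s 0 = (c - 1) * (z (Suc 0) * F / (F + t (Suc 0)))"
    using cons.prems(5) by (simp add: xs tau_Cons[OF cons.hyps] z t F_def)
  have sum: "s 0 + z (Suc 0) = h * z (Suc 0)"
  proof -
    have "(s 0 + z (Suc 0)) * (F + t (Suc 0)) = h * z (Suc 0) * (F + t (Suc 0))"
      using S' hS by (simp add: s0 field_simps) algebra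
    then show ?thesis using S' by simp
  qed
  have s1: "s 0 * t (Suc 0) / (s 0 + z (Suc 0)) = (c / h - 1) * F"
  proof -
    have "s 0 * t (Suc 0) * (F + t (Suc 0)) = (c - h) * F * z (Suc 0) * (F + t (Suc 0))"
      using S' hS by (simp add: s0 field_simps) algebra
    then have "s 0 * t (Suc 0) = (c - h) * F * z (Suc 0)" using S' by simp
    then show ?thesis unfolding sum using h0 nz by (simp add: field_simps)
  qed
  have s: "s (Suc i) = slide_weight (\<lambda>i. z (Suc i)) (\<lambda>i. t (Suc i)) ((c / h - 1) * F) i" for i
    using s1 cons.prems(5) by (simp only: slide_weight_Suc slide_weight.simps(1))
  have IH: "(\<forall>i<length ts. s (Suc i) + z (Suc (Suc i)) \<noteq> 0 \<and>
      gc_act (crystal_tau n ts) j (c / h) xs' ! i =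
        gc_act (basic_crystal n (ts ! i)) j ((s (Suc i) + z (Suc (Suc i))) / z (Suc (Suc i))) (xs' ! i)) \<and>
     s (Suc (length ts)) = (1 - inverse (c / h)) * gc_eps (crystal_tau n ts) j xs'"
    by (rule cons.IH[of "c / h" xs' "\<lambda>i. z (Suc i)" "\<lambda>i. t (Suc i)" "\<lambda>i. s (Suc i)"])
      (use cons.prems(1) h0 reg cons.prems(3)[of "Suc _"] cons.prems(4)[of "Suc _"] in
        \<open>simp_all add: xs s h_def F_def\<close>)
  have "s (Suc (length ts)) = (1 - inverse c) * gc_eps (crystal_tau n (b # ts)) j xs"
  proof -
    \<comment> \<open>relates the closing weight for parameter \<open>c / h\<close> to the one for \<open>c\<close>\<close>
    have "(1 - h / c) * (F + t (Suc 0)) = (1 - inverse c) * t (Suc 0)"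
      using hS cons.prems(1) by (simp add: field_simps)
    then have "1 - inverse (c / h) = (1 - inverse c) * t (Suc 0) / (F + t (Suc 0))"
      using S' by (simp add: eq_divide_eq)
    then show ?thesis using IH by (simp add: xs tau_Cons[OF cons.hyps] t F_def)
  qed
  moreover have "s i + z (Suc i) \<noteq> 0 \<and> gc_act (crystal_tau n (b # ts)) j c xs ! i =
     gc_act (basic_crystal n ((b # ts) ! i)) j ((s i + z (Suc i)) / z (Suc i)) (xs ! i)"
    if "i < length (b # ts)" for i
  proof (cases i)
    case 0
    then show ?thesis using sum nz h0 by (simp add: xs tau_Cons[OF cons.hyps] h_def)
  next
    case (Suc k)
    then show ?thesis using IH that by (simp add: xs tau_Cons[OF cons.hyps] h_def)
  qed
  ultimately show ?case by (simp del: slide_weight.simps)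
qed


section \<open>Density of the regular points\<close>

text \<open>
  At \<open>c = 1\<close> every \<open>c\<^sup>+\<close> is 1.
\<close>

lemma tau_act_reg_1:
  assumes "j < n"
  shows "ts \<noteq> [] \<Longrightarrow> xs \<in> gc_reg (crystal_tau n ts) j \<Longrightarrow> xs \<in> gc_act_reg (crystal_tau n ts) j 1"
  by (induction ts arbitrary: xs rule: list_nonempty_induct)
    (auto simp: tau_single tau_Cons head_c_plus_eq)

lemma inj_on_moebius:
  fixes a b c d :: complex
  assumes "a * d \<noteq> b * c"
  shows "inj_on (\<lambda>x. (a * x + b) / (c * x + d)) {x. c * x + d \<noteq> 0}"
proof (rule inj_onI)
  fix x y
  assume "x \<in> {x. c * x + d \<noteq> 0}" "y \<in> {x. c * x + d \<noteq> 0}"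
    "(a * x + b) / (c * x + d) = (a * y + b) / (c * y + d)"
  then have "(a * x + b) * (c * y + d) = (a * y + b) * (c * x + d)"
    by (simp add: divide_eq_eq eq_divide_eq mult.commute)
  then have "(a * d - b * c) * (x - y) = 0" by algebra
  then show "x = y" using assms by simp
qed

lemma finite_moebius_preimage:
  fixes a b c d :: complex
  assumes "a * d \<noteq> b * c" "finite B"
  shows "finite {x. c * x + d \<noteq> 0 \<and> (a * x + b) / (c * x + d) \<in> B}"
  using finite_vimage_IntI[OF assms(2) inj_on_moebius[OF assms(1)]]
  by (rule finite_subset[rotated]) auto

lemma finite_linear_root: "(a::complex) \<noteq> 0 \<or> b \<noteq> 0 \<Longrightarrow> finite {x. a * x + b = 0}"
proof (cases "a = 0")
  case False
  then have "{x. a * x + b = 0} \<subseteq> {- b / a}" by (auto simp: field_simps add_eq_0_iff)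
  then show ?thesis by (rule finite_subset) simp
qed auto

text \<open>
  The parameter passed on to the remaining factors is \<open>c (\<phi>' + \<epsilon>) / (c \<phi>' + \<epsilon>)\<close>, an injective function of \<open>c\<close>
  because \<open>(\<phi>' + \<epsilon>) \<epsilon> \<noteq> 0\<close>. So it takes each of their finitely many exceptional values at most once, and
  one further exception is the zero of its denominator.
\<close>

lemma tau_act_reg_cofinite:
  assumes "j < n"
  shows "ts \<noteq> [] \<Longrightarrow> xs \<in> gc_reg (crystal_tau n ts) j \<Longrightarrow>
    finite {c. c \<noteq> 0 \<and> xs \<notin> gc_act_reg (crystal_tau n ts) j c}"
proof (induction ts arbitrary: xs rule: list_nonempty_induct)
  case (single b)
  then have "{c. c \<noteq> 0 \<and> xs \<notin> gc_act_reg (crystal_tau n [b]) j c} = {}"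
    by (auto simp: tau_single)
  then show ?case by (simp only: finite.emptyI)
next
  case (cons b ts)
  obtain x xs' where xs: "xs = x # xs'" and x: "x \<in> torus n" and reg: "xs' \<in> gc_reg (crystal_tau n ts) j"
    and nz: "gc_phi (crystal_tau n ts) j xs' + gc_eps (basic_crystal n b) j x \<noteq> 0"
    using cons.prems(1) by (auto simp: tau_Cons[OF cons.hyps])
  define F where "F = gc_phi (crystal_tau n ts) j xs'"
  define t where "t = gc_eps (basic_crystal n b) j x"
  define B where "B = {c. c \<noteq> 0 \<and> xs' \<notin> gc_act_reg (crystal_tau n ts) j c}"
  have t: "t \<noteq> 0" using basic_nonzero[OF x assms] by (simp add: t_def)
  have S: "F + t \<noteq> 0" using nz by (simp add: F_def t_def)
  have "finite B" unfolding B_def by (rule cons.IH[OF reg])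
  then have fin1: "finite {c. F * c + t \<noteq> 0 \<and> ((F + t) * c + 0) / (F * c + t) \<in> B}"
    using S t by (intro finite_moebius_preimage) auto
  have fin2: "finite {c. F * c + t = 0}" using t by (intro finite_linear_root) simp
  have "c \<in> {c. F * c + t \<noteq> 0 \<and> ((F + t) * c + 0) / (F * c + t) \<in> B} \<union> {c. F * c + t = 0}"
    if c: "c \<noteq> 0" "xs \<notin> gc_act_reg (crystal_tau n (b # ts)) j c" for c
  proof -
    have "F * c + t \<noteq> 0 \<longrightarrow> c / ((c * F + t) / (F + t)) \<in> B"
      using c x reg nz S unfolding B_def
      by (auto simp: xs tau_Cons[OF cons.hyps] head_c_plus_eq F_def[symmetric] t_def[symmetric]
          mult.commute)
    then show ?thesis by (auto simp: mult.commute)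
  qed
  then show ?case by (intro finite_subset[OF _ finite_UnI[OF fin1 fin2]]) blast
qed

lemma exists_near_outside_finite:
  fixes e :: complex
  assumes "finite B" "d > 0"
  shows "\<exists>f. cmod (f - e) < d \<and> f \<notin> B"
proof (rule ccontr)
  assume "\<not> ?thesis"
  then have "(\<lambda>r. e + complex_of_real r) ` {0<..<d} \<subseteq> B" by auto
  then have "finite ((\<lambda>r. e + complex_of_real r) ` {0<..<d})" using assms(1) by (rule finite_subset)
  then have "finite {0<..<d}" by (rule finite_imageD) (auto simp: inj_on_def)
  then show False using assms(2) infinite_Ioo by blast
qed

text \<open>
  The remaining factors are first moved to a point that is merely regular; their exceptional parameters then form a
  finite set, which is avoided by varying the \<open>\<epsilon>\<close>-coordinate \<open>e\<close> of the first factor. For \<open>c \<noteq> 1\<close> the parameter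
  passed on is an injective function of \<open>e\<close>; for \<open>c = 1\<close> it is constantly 1, which is never exceptional.
\<close>

lemma tau_dense:
  assumes j: "j < n"
  shows "ts \<noteq> [] \<Longrightarrow> xs \<in> gc_points (crystal_tau n ts) \<Longrightarrow> c \<noteq> 0 \<Longrightarrow> d > 0 \<Longrightarrow>
    \<exists>ys \<in> gc_reg (crystal_tau n ts) j \<inter> gc_act_reg (crystal_tau n ts) j c.
      \<forall>k<length ts. \<forall>i<n. cmod ((ys ! k) i - (xs ! k) i) < d"
proof (induction ts arbitrary: xs c rule: list_nonempty_induct)
  case (single b)
  then show ?case by (auto simp: tau_single intro!: bexI)
next
  case (cons b ts)
  obtain x xs' where xs: "xs = x # xs'" and x: "x \<in> torus n"
    and xs': "xs' \<in> gc_points (crystal_tau n ts)"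
    using cons.prems(1) by (auto simp: tau_Cons[OF cons.hyps])
  obtain ys where ys: "ys \<in> gc_reg (crystal_tau n ts) j"
    and near: "\<And>k i. k < length ts \<Longrightarrow> i < n \<Longrightarrow> cmod ((ys ! k) i - (xs' ! k) i) < d"
    \<comment> \<open>any nonzero parameter serves here, since regularity of \<open>ys\<close> is what is carried on\<close>
    using cons.IH[OF xs', of 1] cons.prems(3) by auto
  define F where "F = gc_phi (crystal_tau n ts) j ys"
  define B where "B = {c. c \<noteq> 0 \<and> ys \<notin> gc_act_reg (crystal_tau n ts) j c}"
  have F: "F \<noteq> 0" using tau_nonzero[OF j cons.hyps ys] by (simp add: F_def)
  have B: "finite B" unfolding B_def by (rule tau_act_reg_cofinite[OF j cons.hyps ys])
  have "1 \<notin> B" using tau_act_reg_1[OF j cons.hyps ys] by (simp add: B_def)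
  have "finite {e. 1 * e + c * F \<noteq> 0 \<and> (c * e + c * F) / (1 * e + c * F) \<in> B}"
  proof (cases "c = 1")
    case True
    then have "{e. 1 * e + c * F \<noteq> 0 \<and> (c * e + c * F) / (1 * e + c * F) \<in> B} = {}"
      using \<open>1 \<notin> B\<close> by auto
    then show ?thesis by (simp only: finite.emptyI)
  next
    case False
    then show ?thesis using F cons.prems(2) B by (intro finite_moebius_preimage) auto
  qed
  then have "finite ({0, - F, - (c * F)} \<union> {e. 1 * e + c * F \<noteq> 0 \<and> (c * e + c * F) / (1 * e + c * F) \<in> B})"
    by simp
  from exists_near_outside_finite[OF this cons.prems(3)]
  obtain e where e: "cmod (e - gc_eps (basic_crystal n b) j x) < d"
    and avoid: "e \<noteq> 0" "e \<noteq> - F" "e \<noteq> - (c * F)" "e + c * F \<noteq> 0 \<Longrightarrow> (c * e + c * F) / (e + c * F) \<notin> B"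
    by auto
  \<comment> \<open>\<open>\<epsilon>\<^sub>j\<close> is the coordinate \<open>j + 1\<close> for a whirl and \<open>j\<close> for a curl\<close>
  define y where "y = x((if b = TypeM then Suc j mod n else j) := e)"
  have y: "y \<in> torus n" "gc_eps (basic_crystal n b) j y = e"
    using x avoid(1) by (cases b; auto simp: y_def torus_def crystal_M_def crystal_N_def)+
  have near_y: "cmod (y i - x i) < d" for i
    using e cons.prems(3) by (cases b) (auto simp: y_def crystal_M_def crystal_N_def)
  have nz: "F + e \<noteq> 0" "c * F + e \<noteq> 0" using avoid(2,3) by (auto simp: add_eq_0_iff minus_equation_iff)
  have "c / ((c * F + e) / (F + e)) = (c * e + c * F) / (e + c * F)"
    by (simp add: distrib_left add.commute)
  then have "ys \<in> gc_act_reg (crystal_tau n ts) j (c / ((c * F + e) / (F + e)))"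
    using avoid(4) nz cons.prems(2) by (auto simp: B_def add.commute)
  then have "y # ys \<in> gc_reg (crystal_tau n (b # ts)) j \<inter> gc_act_reg (crystal_tau n (b # ts)) j c"
    using y ys nz by (simp add: tau_Cons[OF cons.hyps] head_c_plus_eq F_def)
  moreover have "\<forall>k<length (b # ts). \<forall>i<n. cmod (((y # ys) ! k) i - (xs ! k) i) < d"
    using near near_y by (auto simp: xs nth_Cons split: nat.split)
  ultimately show ?case by blast
qed


section \<open>The cylindric network\<close>

lemma pred_Suc_mod: "j < n \<Longrightarrow> (Suc j mod n + n - 1) mod n = j"
  by (cases "Suc j = n") auto

lemma Suc_pred_mod: "j < n \<Longrightarrow> Suc ((j + n - 1) mod n) mod n = j"
  by (simp add: mod_Suc_eq)

lemma cycle_step_less: "j < n \<Longrightarrow> cycle_step n b j < n"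
  by (cases b) simp_all

lemma Suc_mod_eq_iff:
  assumes "j < n" "k < n"
  shows "Suc j mod n = Suc k mod n \<longleftrightarrow> j = k"
proof
  assume eq: "Suc j mod n = Suc k mod n"
  show "j = k"
    by (rule trans[OF pred_Suc_mod[OF assms(1), symmetric, unfolded eq] pred_Suc_mod[OF assms(2)]])
qed simp

lemma pred_mod_eq_iff:
  fixes j k n :: nat
  assumes "j < n" "k < n"
  shows "(j + n - 1) mod n = (k + n - 1) mod n \<longleftrightarrow> j = k"
proof
  assume eq: "(j + n - 1) mod n = (k + n - 1) mod n"
  show "j = k"
    by (rule trans[OF Suc_pred_mod[OF assms(1), symmetric, unfolded eq] Suc_pred_mod[OF assms(2)]])
qed simp

lemma cycle_step_eq_iff: "j < n \<Longrightarrow> k < n \<Longrightarrow> cycle_step n b j = cycle_step n b k \<longleftrightarrow> j = k"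
  by (cases b) (simp_all only: cycle_step.simps Suc_mod_eq_iff pred_mod_eq_iff)

text \<open>
  Horizontal steps never merge because the column increases by one, and steps along a cycle permute the rows. Tails and
  heads are equally many, so injectivity suffices.
\<close>

lemma cyl_nxt_bij:
  "bij_betw (cyl_nxt n ts)
     (Bd ` Source ` {..<n} \<union> {St v r | v r. v \<in> {..<length ts} \<times> {..<n}})
     (Bd ` Sink ` {..<n} \<union> {St v r | v r. v \<in> {..<length ts} \<times> {..<n}})"
  (is "bij_betw ?f (?A \<union> ?S) (?B \<union> ?S)")
proof -
  have S: "?S = (\<lambda>(v, r). St v r) ` (({..<length ts} \<times> {..<n}) \<times> UNIV)" by auto
  have "finite (UNIV :: role set)"
    by (rule finite_subset[of _ "{Hi, Lo}"]) (auto intro: role.exhaust)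
  then have fin: "finite ?S" unfolding S by (intro finite_imageI finite_cartesian_product) auto
  have "card ?A = n" "card ?B = n"
    by (simp_all add: card_image inj_on_def)
  moreover have "?A \<inter> ?S = {}" "?B \<inter> ?S = {}" by auto
  ultimately have card: "card (?A \<union> ?S) = card (?B \<union> ?S)"
    using fin by (simp add: card_Un_disjoint)
  have inj: "inj_on ?f (?A \<union> ?S)"
    by (rule inj_onI)
      (auto simp: horizontal_node_def cycle_step_eq_iff split: if_splits,
        metis Suc_inject Suc_lessI)
  have "?f ` (?A \<union> ?S) \<subseteq> ?B \<union> ?S"
    by (auto simp: horizontal_node_def cycle_step_less)
  then have "?f ` (?A \<union> ?S) = ?B \<union> ?S"
    using fin card card_image[OF inj] by (intro card_subset_eq) auto
  then show ?thesis using inj by (simp add: bij_betw_def)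
qed

lemma cyl_bnxt_bij:
  "bij_betw (cyl_bnxt n) (Source ` {..<n} \<union> Sink ` {..<n}) (Source ` {..<n} \<union> Sink ` {..<n})"
proof -
  let ?g = "\<lambda>x. case x of Source j \<Rightarrow> Source ((j + n - 1) mod n) | Sink j \<Rightarrow> Sink (Suc j mod n)"
  let ?B = "Source ` {..<n} \<union> Sink ` {..<n}"
  have inverse: "?g (cyl_bnxt n x) = x \<and> cyl_bnxt n (?g x) = x \<and> cyl_bnxt n x \<in> ?B \<and> ?g x \<in> ?B"
    if "x \<in> ?B" for x
  proof -
    obtain j where "j < n" "x = Source j \<or> x = Sink j" using \<open>x \<in> ?B\<close> by blast
    moreover have "k mod n < n" for k using \<open>j < n\<close> by simp
    ultimately show ?thesis
      by (elim disjE) (simp_all only: cyl_bnxt.simps cyl_boundary.case pred_Suc_mod Suc_pred_mod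
          Un_iff image_eqI lessThan_iff simp_thms)
  qed
  show ?thesis
    by (rule bij_betw_byWitness[where f' = ?g]) (use inverse in blast)+
qed

lemma wf_cyl_network: "wf_network (cyl_network n ts xs)"
proof -
  have "Source ` {..<n} \<inter> Sink ` {..<n} = {}" by auto
  then show ?thesis
    unfolding wf_network_def strands_def cyl_network_def network.simps
    using cyl_nxt_bij[of n ts] cyl_bnxt_bij[of n] by blast
qed

lemma cyl_wire_pos:
  "k \<le> length ts \<Longrightarrow> wire_pos (cyl_network n ts xs) (Source j) (Suc k) = horizontal_node ts j k"
proof (induction k)
  case (Suc k)
  then have "wire_pos (cyl_network n ts xs) (Source j) (Suc (Suc k))
      = cyl_nxt n ts (horizontal_node ts j k)"
    by (simp add: wire_pos_def cyl_network_def)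
  then show ?case using Suc.prems by (simp add: horizontal_node_def)
qed (simp add: wire_pos_def cyl_network_def)

lemma cyl_wire_len: "wire_len (cyl_network n ts xs) (Source j) = length ts"
  unfolding wire_len_def wire_pos_def[symmetric]
proof (rule Least_equality)
  show "\<exists>t. wire_pos (cyl_network n ts xs) (Source j) (Suc (length ts)) = Bd t"
    by (simp add: cyl_wire_pos horizontal_node_def)
  show "length ts \<le> k" if "\<exists>t. wire_pos (cyl_network n ts xs) (Source j) (Suc k) = Bd t" for k
    using that by (cases "k \<le> length ts") (auto simp: cyl_wire_pos horizontal_node_def split: if_splits)
qed

lemma cyl_wire_strand:
  "k < length ts \<Longrightarrow>
   wire_pos (cyl_network n ts xs) (Source j) (Suc k) = St (k, j) (horizontal_role (ts ! k))"
  by (simp add: cyl_wire_pos horizontal_node_def)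

lemma cyl_crossed:
  assumes "k < length ts"
  shows "crossed_from_right (cyl_network n ts xs) (Source j) (Suc k) \<longleftrightarrow> ts ! k = TypeM"
    and "crossed_from_left (cyl_network n ts xs) (Source j) (Suc k) \<longleftrightarrow> ts ! k = TypeN"
  using assms by (cases "ts ! k"; simp add: crossed_from_right_def crossed_from_left_def cyl_wire_strand)+

text \<open>
  Each cycle has exactly one edge in the strip. It leads up to \<open>W\<close> for a whirl, which \<open>W\<close> and \<open>W'\<close> cross as
  highways, and down to \<open>W'\<close> for a curl. As \<open>n \<ge> 2\<close>, the two wires are distinct.
\<close>

lemma cyl_parallel:
  assumes "n \<ge> 2" "j < n"
  shows "parallel_wires (cyl_network n ts xs) (Source j) (Source (Suc j mod n))"
proof -
  let ?N = "cyl_network n ts xs" and ?j = "Suc j mod n" and ?m = "length ts"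
  have ne: "?j \<noteq> j" "?j < n" using assms by (auto simp: mod_Suc)
  have cross: "wire_crossing ?N (Source i) k = (k - 1, i)" if "k \<in> {1..?m}" for i k
    using that cyl_wire_strand[of "k - 1" ts n xs i] by (cases k) simp_all
  have "(crossed_from_left ?N (Source j) i \<and> crossed_from_left ?N (Source ?j) i \<and>
            nxt ?N (St (wire_crossing ?N (Source j) i) Hi) = St (wire_crossing ?N (Source ?j) i) Hi) \<or>
           (crossed_from_right ?N (Source j) i \<and> crossed_from_right ?N (Source ?j) i \<and>
            nxt ?N (St (wire_crossing ?N (Source ?j) i) Lo) = St (wire_crossing ?N (Source j) i) Lo)"
    if i: "i \<in> {1..?m}" for i
  proof -
    obtain k where k: "i = Suc k" "k < ?m" using i by (cases i) auto
    then show ?thesis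
      using cyl_crossed[OF k(2), of n xs] cross[OF i] pred_Suc_mod[OF assms(2)]
      by (cases "ts ! k") (simp_all add: cyl_network_def)
  qed
  moreover have "inj_on (wire_crossing ?N (Source i)) {1..?m}" for i
    by (rule inj_onI) (auto simp: cross)
  moreover have "wire_crossing ?N (Source j) ` {1..?m} \<inter> wire_crossing ?N (Source ?j) ` {1..?m} = {}"
    using ne by (auto simp: cross)
  moreover have "wire_pos ?N (Source i) (Suc ?m) = Bd (Sink i)" for i
    by (simp add: cyl_wire_pos horizontal_node_def)
  moreover have "Source j \<in> srcs ?N" "Source ?j \<in> srcs ?N" "Sink j \<in> snks ?N" "Sink ?j \<in> snks ?N"
    "bnxt ?N (Source j) = Source ?j" "bnxt ?N (Sink ?j) = Sink j"
    using assms ne pred_Suc_mod[OF assms(2)] by (simp_all add: cyl_network_def)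
  ultimately show ?thesis
    unfolding parallel_wires_def using ne(1)
    by (auto simp: cyl_wire_len intro!: exI[of _ "Sink j"] exI[of _ "Sink ?j"])
qed

text \<open>
  A whirl meets \<open>W'\<close> before \<open>W\<close>, a curl \<open>W\<close> before \<open>W'\<close>; the conventions for \<open>X\<^sub>M\<close> and \<open>X\<^sub>N\<close> differ in the same way.
\<close>

lemma cyl_weights:
  assumes "k < length ts"
  shows "z_wt (cyl_network n ts xs) (Source j) (Source (Suc j mod n)) (Suc k) =
      gc_phi (basic_crystal n (ts ! k)) j (xs ! k)"
    and "t_wt (cyl_network n ts xs) (Source j) (Source (Suc j mod n)) (Suc k) =
      gc_eps (basic_crystal n (ts ! k)) j (xs ! k)"
proof -
  have "weight (cyl_network n ts xs) (k, i) = (xs ! k) i" for i by (simp add: cyl_network_def)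
  then show "z_wt (cyl_network n ts xs) (Source j) (Source (Suc j mod n)) (Suc k) =
      gc_phi (basic_crystal n (ts ! k)) j (xs ! k)"
    "t_wt (cyl_network n ts xs) (Source j) (Source (Suc j mod n)) (Suc k) =
      gc_eps (basic_crystal n (ts ! k)) j (xs ! k)"
    using assms by (cases "ts ! k"; simp add: z_wt_def t_wt_def cyl_crossed cyl_wire_strand
        crystal_M_def crystal_N_def)+
qed


section \<open>The network model\<close>

text \<open>
  The factor \<open>(s i + z) / z\<close> by which the moves scale \<open>z\<close> and \<open>1 / t\<close> is the parameter with which the product acts on
  the \<open>i\<close>-th factor.
\<close>

lemma cyl_action:
  fixes n j :: nat and ts :: "basic_type list" and xs :: "(nat \<Rightarrow> complex) list" and c :: complex
  assumes n: "n \<ge> 2" and ts: "ts \<noteq> []" and j: "j < n" and c: "c \<noteq> 0"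
    and xs: "xs \<in> gc_act_reg (crystal_tau n ts) j c"
    and eps: "wiring_eps (cyl_network n ts xs) (Source j) (Source (Suc j mod n)) = gc_eps (crystal_tau n ts) j xs"
    and phi: "wiring_phi (cyl_network n ts xs) (Source j) (Source (Suc j mod n)) = gc_phi (crystal_tau n ts) j xs"
  shows "\<exists>N'. wiring_action c (Source j) (Source (Suc j mod n)) (cyl_network n ts xs) N'"
    and "wiring_action c (Source j) (Source (Suc j mod n)) (cyl_network n ts xs) N' \<Longrightarrow>
      network_iso N' (cyl_network n ts (gc_act (crystal_tau n ts) j c xs))"
proof -
  let ?N = "cyl_network n ts xs" and ?j = "Suc j mod n" and ?ys = "gc_act (crystal_tau n ts) j c xs"
  let ?W = "Source j" and ?W' = "Source ?j" and ?m = "length ts"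
  define z where "z = z_wt ?N ?W ?W'"
  define t where "t = t_wt ?N ?W ?W'"
  define s where "s = slide_weight z t ((c - 1) * gc_phi (crystal_tau n ts) j xs)"
  have j': "?j \<noteq> j" "j \<noteq> ?j" using n j by (auto simp: mod_Suc)
  have z: "z (Suc i) = gc_phi (basic_crystal n (ts ! i)) j (xs ! i)"
    and t: "t (Suc i) = gc_eps (basic_crystal n (ts ! i)) j (xs ! i)" if "i < ?m" for i
    using cyl_weights[OF that] by (simp_all add: z_def t_def)
  have tau: "(\<forall>i<?m. s i + z (Suc i) \<noteq> 0 \<and> ?ys ! i =
        gc_act (basic_crystal n (ts ! i)) j ((s i + z (Suc i)) / z (Suc i)) (xs ! i)) \<and>
      s ?m = (1 - inverse c) * gc_eps (crystal_tau n ts) j xs"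
    by (rule tau_action[OF j ts c xs z t s_def])
  then have final: "s ?m = (1 - inverse c) * gc_eps (crystal_tau n ts) j xs" by blast
  have act: "s i + z (Suc i) \<noteq> 0" "?ys ! i =
        gc_act (basic_crystal n (ts ! i)) j ((s i + z (Suc i)) / z (Suc i)) (xs ! i)"
    if "i < ?m" for i
    using tau that by blast+
  have nz: "z (Suc i) \<noteq> 0" if "i < ?m" for i
    using tau_factor_nonzero[OF j ts tau_act_reg_reg[OF ts xs] that] z[OF that] by simp
  define w where "w = (\<lambda>(k, i). (?ys ! k) i)"
  have w: "(cyl_network n ts xs)\<lparr>weight := w\<rparr> = cyl_network n ts ?ys"
    by (simp add: cyl_network_def w_def)
  have crossings: "z_crossing ?N ?W ?W' (Suc i) = (i, if ts ! i = TypeM then j else ?j)"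
    "t_crossing ?N ?W ?W' (Suc i) = (i, if ts ! i = TypeM then ?j else j)" if "i < ?m" for i
    using that by (simp_all add: z_crossing_def t_crossing_def cyl_crossed cyl_wire_strand)
  have inf: "infinite (UNIV :: (nat \<times> nat) set)" by (simp add: finite_prod)
  have w_z: "w (z_crossing ?N ?W ?W' (Suc i)) = s i + z (Suc i)"
    and w_t: "w (t_crossing ?N ?W ?W' (Suc i)) = t (Suc i) * z (Suc i) / (s i + z (Suc i))"
    if i: "i < ?m" for i
    using act[OF i] nz[OF i] j' z[OF i] t[OF i]
    by (cases "ts ! i"; simp add: crossings[OF i] w_def crystal_M_def crystal_N_def)+
  have w_else: "w v = weight ?N v"
    if v: "v \<in> verts ?N" "v \<notin> t_crossing ?N ?W ?W' ` {1..?m} \<union> z_crossing ?N ?W ?W' ` {1..?m}" for v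
  proof -
    obtain k i where ki: "v = (k, i)" "k < ?m" using v(1) by (auto simp: cyl_network_def)
    have "Suc k \<in> {1..?m}" using ki by simp
    then have "v \<noteq> t_crossing ?N ?W ?W' (Suc k)" "v \<noteq> z_crossing ?N ?W ?W' (Suc k)"
      using v(2) by blast+
    then have "i \<noteq> j" "i \<noteq> ?j" using ki by (auto simp: crossings split: if_splits)
    then have "(?ys ! k) i = (xs ! k) i"
      using act(2)[OF ki(2)] by (cases "ts ! k") (simp_all add: crystal_M_def crystal_N_def)
    then show ?thesis by (simp add: w_def ki cyl_network_def)
  qed
  have len: "wire_len ?N ?W = ?m" by (rule cyl_wire_len)
  note reweights = wiring_action_reweights[where N = ?N and W = ?W and W' = ?W' and c = c and w = w,
      OF inf wf_cyl_network cyl_parallel[OF n j], unfolded phi eps len, folded z_def t_def,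
      folded s_def, OF act(1) final w_z w_t w_else]
  show "\<exists>N'. wiring_action c ?W ?W' ?N N'" by (rule reweights(1))
  show "wiring_action c ?W ?W' ?N N' \<Longrightarrow> network_iso N' (cyl_network n ts ?ys)"
    by (rule reweights(2)[unfolded w])
qed

theorem theorem11p7:
  fixes n :: nat and ts :: "basic_type list"
  assumes "n \<ge> 2" and "ts \<noteq> []"
  shows "\<forall>j<n.
    let X = crystal_tau n ts; N = cyl_network n ts;
        W = Source j; W' = Source (Suc j mod n)
    in
      (\<forall>x \<in> gc_points X. wf_network (N x) \<and> parallel_wires (N x) W W') \<and>
      (\<forall>x \<in> gc_reg X j.
         wiring_eps (N x) W W' = gc_eps X j x \<and> wiring_phi (N x) W W' = gc_phi X j x) \<and>
      (\<forall>c. c \<noteq> 0 \<longrightarrow> (\<forall>x \<in> gc_act_reg X j c.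
         (\<exists>N'. wiring_action c W W' (N x) N') \<and>
         (\<forall>N'. wiring_action c W W' (N x) N' \<longrightarrow> network_iso N' (N (gc_act X j c x))))) \<and>
      (\<forall>c. c \<noteq> 0 \<longrightarrow> (\<forall>x \<in> gc_points X. \<forall>d>0. \<exists>y \<in> gc_reg X j \<inter> gc_act_reg X j c.
         \<forall>k<length ts. \<forall>i<n. cmod ((y ! k) i - (x ! k) i) < d))"
proof (intro allI impI)
  fix j assume j: "j < n"
  let ?X = "crystal_tau n ts" and ?N = "cyl_network n ts"
  let ?W = "Source j" and ?W' = "Source (Suc j mod n)"
  have maps: "wiring_eps (?N x) ?W ?W' = gc_eps ?X j x \<and> wiring_phi (?N x) ?W ?W' = gc_phi ?X j x"
    if "x \<in> gc_reg ?X j" for x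
    using tau_closed_form[OF assms(2) that, of "z_wt (?N x) ?W ?W'" "t_wt (?N x) ?W ?W'"]
    by (simp add: cyl_weights wiring_eps_def wiring_phi_def wiring_D_def strip_sum_def cyl_wire_len)
  have action: "(\<exists>N'. wiring_action c ?W ?W' (?N x) N') \<and>
      (\<forall>N'. wiring_action c ?W ?W' (?N x) N' \<longrightarrow> network_iso N' (?N (gc_act ?X j c x)))"
    if "c \<noteq> 0" "x \<in> gc_act_reg ?X j c" for c x
    using cyl_action[OF assms j that] maps[OF tau_act_reg_reg[OF assms(2) that(2)]] by blast
  show "let X = crystal_tau n ts; N = cyl_network n ts;
        W = Source j; W' = Source (Suc j mod n)
    in
      (\<forall>x \<in> gc_points X. wf_network (N x) \<and> parallel_wires (N x) W W') \<and>
      (\<forall>x \<in> gc_reg X j.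
         wiring_eps (N x) W W' = gc_eps X j x \<and> wiring_phi (N x) W W' = gc_phi X j x) \<and>
      (\<forall>c. c \<noteq> 0 \<longrightarrow> (\<forall>x \<in> gc_act_reg X j c.
         (\<exists>N'. wiring_action c W W' (N x) N') \<and>
         (\<forall>N'. wiring_action c W W' (N x) N' \<longrightarrow> network_iso N' (N (gc_act X j c x))))) \<and>
      (\<forall>c. c \<noteq> 0 \<longrightarrow> (\<forall>x \<in> gc_points X. \<forall>d>0. \<exists>y \<in> gc_reg X j \<inter> gc_act_reg X j c.
         \<forall>k<length ts. \<forall>i<n. cmod ((y ! k) i - (x ! k) i) < d))"
    unfolding Let_def
    using wf_cyl_network cyl_parallel[OF assms(1) j] maps action tau_dense[OF j assms(2)] by blast
qed

end
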